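(* Let $u_\sigma\in\mathcal{A}_s$ be a strong local minimizer of $E$ in $\mathcal{A}_s$, i.e. there is $\gamma>0$ such that $E(v)\ge E(u_\sigma)$ for all $v\in\mathcal{A}_s$ with $\|v-u_\sigma\|_{\infty;Q}<\gamma$. Assume that for some constant $M$ $$|\sigma(x_1,x_2)-\sigma(x_1',x_2)|\le M|x_1-x_1'|\qquad\text{for all }(x_1,x_2),(x_1',x_2)\in Q.$$ Then $u_\sigma$ is locally Hölder continuous in the interior of $Q$.
   Context: $Q=[-1,1]^2\subset\mathbb{R}^2$. For scalar $\sigma\in W^{1,2}(Q;\mathbb{R})$ the associated shear map is $u_\sigma(x)=x+\sigma(x)e_2=(x_1,\,x_2+\sigma(x))^T$, so that $\det\nabla u_\sigma=1+\sigma_{,2}$ with $\sigma_{,2}=\partial\sigma/\partial x_2$. A pointwise condition on $\sigma$ refers to a fixed representative of $\sigma$. Energy: $E(u)=\int_Q \lambda|\nabla u|^2+h(\det\nabla u)\,dx$ with $\lambda>0$ fixed and $h:\mathbb{R}\to[0,+\infty]$ satisfying: (H0) $h$ is finite, $C^1$ and strictly convex on $(0,\infty)$; (H1) $\lim_{s\to0+}h(s)=+\infty$; (H2) $h'(1)=0$ and $h(s)=+\infty$ for $s\le0$; (H3) there are constants $q_1>0$ and $q_2$ with $h'(s)\le 2q_1s+q_2$ for all $s>1$; (H4) there are $K>0$ and $s_0>0$ with $h(s/2)\le Kh(s)$ for all $s\in(0,s_0)$. Admissible class: fix a shear map $u_{\sigma_0}$ with $E(u_{\sigma_0})<+\infty$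 and $(\partial Q)_D\subset\partial Q$; then $$\mathcal{A}_s=\{u_\sigma(x)=x+\sigma(x)e_2\in W^{1,2}(Q,\mathbb{R}^2):\ E(u_\sigma)<+\infty,\ u_\sigma=u_{\sigma_0}\text{ on }(\partial Q)_D\text{ in the sense of trace}\}.$$ *)

theory Defs
  imports "HOL-Analysis.Analysis" "HOL-Probability.Essential_Supremum"
begin

section \<open>Test functions and the Sobolev space of order one\<close>

definition partial :: "'n::finite \<Rightarrow> (real^'n \<Rightarrow> real) \<Rightarrow> real^'n \<Rightarrow> real" where
  "partial i f x = frechet_derivative f (at x) (axis i 1)"

primrec Ck :: "nat \<Rightarrow> (real^'n::finite \<Rightarrow> real) \<Rightarrow> bool" where
  "Ck 0 f = continuous_on UNIV f"
| "Ck (Suc k) f = (f differentiable_on UNIV \<and> (\<forall>i. Ck k (partial i f)))"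

definition test_functions :: "(real^'n::finite) set \<Rightarrow> (real^'n \<Rightarrow> real) set" where
  "test_functions \<Omega> =
     {\<phi>. (\<forall>k. Ck k \<phi>) \<and> (\<exists>K. compact K \<and> K \<subseteq> interior \<Omega> \<and> (\<forall>x. x \<notin> K \<longrightarrow> \<phi> x = 0))}"

definition L2 :: "(real^'n::finite) set \<Rightarrow> (real^'n \<Rightarrow> 'b::euclidean_space) set" where
  "L2 \<Omega> = {f. f \<in> borel_measurable (lebesgue_on \<Omega>) \<and>
              integrable (lebesgue_on \<Omega>) (\<lambda>x. (norm (f x))\<^sup>2)}"

text \<open>The functions are total; their values outside \<open>\<Omega>\<close> play no role. A weak partial derivative
  is taken with respect to the interior of \<open>\<Omega>\<close>, so that \<open>\<Omega>\<close> may be a closed domain.\<close>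

definition has_weak_partial ::
  "(real^'n::finite) set \<Rightarrow> 'n \<Rightarrow> (real^'n \<Rightarrow> 'b::euclidean_space) \<Rightarrow> (real^'n \<Rightarrow> 'b) \<Rightarrow> bool" where
  "has_weak_partial \<Omega> i f g \<longleftrightarrow> f \<in> L2 \<Omega> \<and> g \<in> L2 \<Omega> \<and>
     (\<forall>\<phi> \<in> test_functions \<Omega>.
        (\<integral>x. partial i \<phi> x *\<^sub>R f x \<partial>lebesgue_on \<Omega>) = - (\<integral>x. \<phi> x *\<^sub>R g x \<partial>lebesgue_on \<Omega>))"

definition W12 :: "(real^'n::finite) set \<Rightarrow> (real^'n \<Rightarrow> 'b::euclidean_space) set" where
  "W12 \<Omega> = {f \<in> L2 \<Omega>. \<forall>i. \<exists>g. has_weak_partial \<Omega> i f g}"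

text \<open>For members of \<open>W12 \<Omega>\<close> the choice is unique almost everywhere on the interior of \<open>\<Omega>\<close>.\<close>

definition weak_partial ::
  "(real^'n::finite) set \<Rightarrow> 'n \<Rightarrow> (real^'n \<Rightarrow> 'b::euclidean_space) \<Rightarrow> real^'n \<Rightarrow> 'b" where
  "weak_partial \<Omega> i f = (SOME g. has_weak_partial \<Omega> i f g)"

definition weak_grad ::
  "(real^'n::finite) set \<Rightarrow> (real^'n \<Rightarrow> real^'m::finite) \<Rightarrow> real^'n \<Rightarrow> real^'n^'m" where
  "weak_grad \<Omega> u x = (\<chi> j i. weak_partial \<Omega> i u x $ j)"

definition W12_dist_sq ::
  "(real^'n::finite) set \<Rightarrow> (real^'n \<Rightarrow> 'b::euclidean_space) \<Rightarrow> (real^'n \<Rightarrow> 'b) \<Rightarrow> real" where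
  "W12_dist_sq \<Omega> f g =
     (\<integral>x. (norm (f x - g x))\<^sup>2 \<partial>lebesgue_on \<Omega>) +
     (\<Sum>i\<in>UNIV. \<integral>x. (norm (weak_partial \<Omega> i f x - weak_partial \<Omega> i g x))\<^sup>2 \<partial>lebesgue_on \<Omega>)"

section \<open>The square and traces on its boundary\<close>

text \<open>Here \<open>1\<close> is the vector with all entries equal to \<open>1\<close>.\<close>

definition Q :: "(real^2) set" where
  "Q = cbox (- 1) 1"

text \<open>The four edges of \<open>Q\<close>, parametrised by arc length over \<open>[-1,1]\<close>: the \<open>i\<close>-th coordinate is
  fixed to \<open>s \<in> {-1, 1}\<close> and the other coordinate is \<open>t\<close>.\<close>

definition edge :: "2 \<Rightarrow> real \<Rightarrow> real \<Rightarrow> real^2" where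
  "edge i s t = (\<chi> j. if j = i then s else t)"

text \<open>The trace operator is the continuous extension of the restriction map
  \<open>f \<mapsto> f|\<partial>Q\<close> from \<open>W\<^sup>1\<^sup>,\<^sup>2(Q) \<inter> C(Q)\<close> (a dense subspace) to an operator from
  \<open>W\<^sup>1\<^sup>,\<^sup>2(Q)\<close> to \<open>L\<^sup>2(\<partial>Q)\<close>. Its graph is the closure of the graph of the
  restriction map.\<close>

definition has_trace :: "(real^2 \<Rightarrow> 'b::euclidean_space) \<Rightarrow> (real^2 \<Rightarrow> 'b) \<Rightarrow> bool" where
  "has_trace f g \<longleftrightarrow> f \<in> W12 Q \<and>
     (\<forall>i. \<forall>s\<in>{-1, 1}. (\<lambda>t. g (edge i s t)) \<in> borel_measurable (lebesgue_on {-1..1})) \<and>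
     (\<exists>F. (\<forall>n::nat. F n \<in> W12 Q \<and> continuous_on Q (F n)) \<and>
          (\<lambda>n. W12_dist_sq Q (F n) f) \<longlonglongrightarrow> 0 \<and>
          (\<forall>i. \<forall>s\<in>{-1, 1}.
             (\<lambda>n. \<integral>\<^sup>+t. ennreal ((norm (F n (edge i s t) - g (edge i s t)))\<^sup>2)
                  \<partial>lebesgue_on {-1..1}) \<longlonglongrightarrow> 0))"

definition trace_eq_on ::
  "(real^2) set \<Rightarrow> (real^2 \<Rightarrow> 'b::euclidean_space) \<Rightarrow> (real^2 \<Rightarrow> 'b) \<Rightarrow> bool" where
  "trace_eq_on \<Gamma> u v \<longleftrightarrow> (\<exists>g k. has_trace u g \<and> has_trace v k \<and>
     (\<forall>i. \<forall>s\<in>{-1, 1}. AE t in lebesgue_on {-1..1}.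
        edge i s t \<in> \<Gamma> \<longrightarrow> g (edge i s t) = k (edge i s t)))"

section \<open>Shear maps, energy and admissible maps\<close>

definition shear :: "(real^2 \<Rightarrow> real) \<Rightarrow> real^2 \<Rightarrow> real^2" where
  "shear \<sigma> x = x + \<sigma> x *\<^sub>R axis 2 1"

text \<open>The norm on \<open>real^2^2\<close> is the Frobenius norm.\<close>

definition energy :: "real \<Rightarrow> (real \<Rightarrow> ennreal) \<Rightarrow> (real^2 \<Rightarrow> real^2) \<Rightarrow> ennreal" where
  "energy lam h u =
     (\<integral>\<^sup>+x. ennreal (lam * (norm (weak_grad Q u x))\<^sup>2) + h (det (weak_grad Q u x)) \<partial>lebesgue_on Q)"

definition admissible_shears ::
  "real \<Rightarrow> (real \<Rightarrow> ennreal) \<Rightarrow> (real^2) set \<Rightarrow> (real^2 \<Rightarrow> real) \<Rightarrow> (real^2 \<Rightarrow> real^2) set" where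
  "admissible_shears lam h \<Gamma> \<sigma>0 =
     {shear \<sigma> | \<sigma>. shear \<sigma> \<in> W12 Q \<and> energy lam h (shear \<sigma>) < \<infinity> \<and> trace_eq_on \<Gamma> (shear \<sigma>) (shear \<sigma>0)}"

definition strong_local_minimizer ::
  "((real^2 \<Rightarrow> real^2) \<Rightarrow> ennreal) \<Rightarrow> (real^2 \<Rightarrow> real^2) set \<Rightarrow> (real^2 \<Rightarrow> real^2) \<Rightarrow> bool" where
  "strong_local_minimizer E A u \<longleftrightarrow> u \<in> A \<and>
     (\<exists>\<gamma>>0. \<forall>v\<in>A. esssup (lebesgue_on Q) (\<lambda>x. ereal (norm (v x - u x))) < ereal \<gamma> \<longrightarrow> E u \<le> E v)"

definition strictly_convex_on :: "real set \<Rightarrow> (real \<Rightarrow> real) \<Rightarrow> bool" where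
  "strictly_convex_on S f \<longleftrightarrow> convex S \<and>
     (\<forall>x\<in>S. \<forall>y\<in>S. \<forall>t. x \<noteq> y \<and> 0 < t \<and> t < 1 \<longrightarrow>
        f ((1 - t) * x + t * y) < (1 - t) * f x + t * f y)"

text \<open>Locally Hoelder-continuous on \<open>S\<close>, that is, \<open>C\<^sup>0\<^sup>,\<^sup>\<alpha>\<close> on compact subsets of \<open>S\<close>, with one exponent for
  all of them.\<close>

definition locally_Hoelder_on :: "(real^2) set \<Rightarrow> (real^2 \<Rightarrow> real^2) \<Rightarrow> bool" where
  "locally_Hoelder_on S f \<longleftrightarrow>
     (\<exists>\<alpha>. 0 < \<alpha> \<and> \<alpha> \<le> 1 \<and> (\<forall>K. compact K \<and> K \<subseteq> S \<longrightarrow>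
        (\<exists>C. \<forall>x\<in>K. \<forall>y\<in>K. dist (f x) (f y) \<le> C * dist x y powr \<alpha>)))"

end

(* The second component y of a shear map has a weak derivative G in L^2 in the direction x2 and is
   M-Lipschitz in x1. Testing with products of bumps shows that, over a strip of width r, the mean
   values of y on two rectangles contained in a common rectangle r x d differ by at most
   (1/r) times the integral of |G| over that rectangle, hence by at most sqrt(d/r) ||G||. Passing
   from the strip to small squares costs another M r. By Lebesgue's differentiation theorem,
   |y(x) - y(z)| <= 2 M r + sqrt(d/r) ||G|| for almost all x and z at distance at most r and d in
   the two coordinates, and r = d^(1/3) gives Hoelder continuity with exponent 1/3. *)

theory Submission
  imports Defs
begin

section \<open>Smooth functions on the line and bumps\<close>

text \<open>On a single vertical line the fundamental theorem of calculus would give exponent 1/2,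
  but the L^2 norm of \<open>G\<close> along the line is finite for almost every line only and has
  no common bound. A strip of positive width replaces it by the norm over \<open>Q\<close> at the
  price of a factor 1/sqrt r, and the Lipschitz bound pays for the way back to points. All
  comparisons are between integrals, so no representative that is absolutely continuous on lines has
  to be constructed.

  The test functions must be smooth in the sense of \<open>Ck\<close> and have an explicit
  derivative in direction 2, so they are built by hand from exp(-1/x). Since a weak derivative sees
  a function only up to null sets, the Hoelder bound is obtained off a null set, and the
  representative in the conclusion is a continuous extension from there.\<close>

primrec Cn :: "nat \<Rightarrow> (real \<Rightarrow> real) \<Rightarrow> bool" where
  "Cn 0 f = continuous_on UNIV f"
| "Cn (Suc k) f = (\<exists>f'. (\<forall>x. (f has_real_derivative f' x) (at x)) \<and> Cn k f')"

text \<open>The functions exp(-1/x) x^(-k), continued by 0 to x \<le> 0. The index makes the family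
  closed under differentiation up to linear combinations, so that smoothness is a single induction;
  the bumps are made of \<open>flat_exp 0\<close>.\<close>

definition flat_exp :: "nat \<Rightarrow> real \<Rightarrow> real" where
  "flat_exp k x = (if x > 0 then exp (- inverse x) * inverse x ^ k else 0)"

declare Cn.simps(2) [simp del]

text \<open>The derivative is always supplied as an explicit function, so each closure property
  below is one calculus rule followed by the induction hypothesis.\<close>

lemma Cn_SucI:
  "(\<And>x. (f has_real_derivative f' x) (at x)) \<Longrightarrow> Cn k f' \<Longrightarrow> Cn (Suc k) f"
  unfolding Cn.simps(2) by blast

lemma continuous_on_UNIV_if_DERIV:
  fixes f :: "real \<Rightarrow> real"
  assumes "\<And>x. (f has_real_derivative f' x) (at x)"
  shows "continuous_on UNIV f"
  using assms by (auto simp: continuous_on_eq_continuous_at intro: DERIV_isCont)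

text \<open>The product rule pairs a derivative with an undifferentiated factor, whose order has to
  be lowered by one to match.\<close>

lemma Cn_SucD: "Cn (Suc k) f \<Longrightarrow> Cn k f"
proof (induction k arbitrary: f)
  case 0
  then show ?case unfolding Cn.simps(2) by (auto intro: continuous_on_UNIV_if_DERIV)
next
  case (Suc k)
  obtain f' where "\<And>x. (f has_real_derivative f' x) (at x)" "Cn (Suc k) f'"
    using Suc.prems unfolding Cn.simps(2)[of "Suc k"] by blast
  then show ?case by (intro Cn_SucI[of f f'] Suc.IH)
qed

lemma Cn_const: "Cn k (\<lambda>x. c)"
  by (induction k arbitrary: c) (simp, rule Cn_SucI[where f'="\<lambda>x. 0"], auto)

lemma Cn_add: "Cn k f \<Longrightarrow> Cn k g \<Longrightarrow> Cn k (\<lambda>x. f x + g x)"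
proof (induction k arbitrary: f g)
  case 0
  then show ?case by (simp add: continuous_on_add)
next
  case (Suc k)
  obtain f' where f: "\<And>x. (f has_real_derivative f' x) (at x)" "Cn k f'"
    using Suc.prems(1) unfolding Cn.simps(2) by blast
  obtain g' where g: "\<And>x. (g has_real_derivative g' x) (at x)" "Cn k g'"
    using Suc.prems(2) unfolding Cn.simps(2) by blast
  show ?case
    by (rule Cn_SucI[OF DERIV_add[OF f(1) g(1)] Suc.IH[OF f(2) g(2)]])
qed

lemma Cn_mult: "Cn k f \<Longrightarrow> Cn k g \<Longrightarrow> Cn k (\<lambda>x. f x * g x)"
proof (induction k arbitrary: f g)
  case 0
  then show ?case by (simp add: continuous_on_mult)
next
  case (Suc k)
  obtain f' where f: "\<And>x. (f has_real_derivative f' x) (at x)" "Cn k f'"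
    using Suc.prems(1) unfolding Cn.simps(2) by blast
  obtain g' where g: "\<And>x. (g has_real_derivative g' x) (at x)" "Cn k g'"
    using Suc.prems(2) unfolding Cn.simps(2) by blast
  have "Cn k (\<lambda>x. f' x * g x + g' x * f x)"
    using f(2) g(2) Suc.prems[THEN Cn_SucD] by (intro Cn_add Suc.IH)
  then show ?case
    by (rule Cn_SucI[OF DERIV_mult[OF f(1) g(1)]])
qed

lemma Cn_affine: "Cn k f \<Longrightarrow> Cn k (\<lambda>x. f (a * x + b))"
proof (induction k arbitrary: f)
  case 0
  then show ?case by (auto intro!: continuous_on_compose2[of UNIV f] continuous_intros)
next
  case (Suc k)
  obtain f' where f: "\<And>x. (f has_real_derivative f' x) (at x)" "Cn k f'"
    using Suc.prems(1) unfolding Cn.simps(2) by blast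
  have "((\<lambda>x. f (a * x + b)) has_real_derivative f' (a * x + b) * a) (at x)" for x
    by (rule DERIV_chain2[where f=f, OF f(1)]) (auto intro!: derivative_eq_intros)
  moreover have "Cn k (\<lambda>x. f' (a * x + b) * a)"
    by (rule Cn_mult[OF Suc.IH[OF f(2)] Cn_const])
  ultimately show ?case by (rule Cn_SucI)
qed

text \<open>The substitution t = 1/x turns this into the decay of t^k / exp t at infinity.\<close>

lemma flat_exp_tendsto_0: "(flat_exp k \<longlongrightarrow> 0) (at_right 0)"
proof -
  have "((\<lambda>x. inverse x ^ k / exp (inverse x)) \<longlongrightarrow> 0) (at_right (0::real))"
    by (rule filterlim_compose[OF tendsto_power_div_exp_0 filterlim_inverse_at_top_right])
  moreover have "\<forall>\<^sub>F x in at_right 0. inverse x ^ k / exp (inverse x) = flat_exp k x"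
    by (auto simp: eventually_at_filter flat_exp_def exp_minus field_simps)
  ultimately show ?thesis
    by (rule Lim_transform_eventually)
qed

lemma flat_exp_has_derivative:
  "(flat_exp k has_real_derivative flat_exp (k + 2) x - of_nat k * flat_exp (Suc k) x) (at x)"
proof -
  consider "x > 0" | "x < 0" | "x = 0" by linarith
  then show ?thesis
  proof cases
    case 1
    have inv: "(inverse has_real_derivative - (inverse x)\<^sup>2) (at x)"
      using 1 DERIV_inverse[of x UNIV] by (simp add: numeral_2_eq_2)
    have "((\<lambda>x. exp (- inverse x)) has_real_derivative exp (- inverse x) * (inverse x)\<^sup>2) (at x)"
      using DERIV_fun_exp[OF DERIV_minus[OF inv]] by simp
    moreover have "((\<lambda>x. inverse x ^ k) has_real_derivative - of_nat k * inverse x ^ Suc k) (at x)"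
      using DERIV_power[OF inv, of k] by (cases k) (simp_all add: power2_eq_square algebra_simps)
    ultimately have "((\<lambda>x. exp (- inverse x) * inverse x ^ k) has_real_derivative
        exp (- inverse x) * (inverse x)\<^sup>2 * inverse x ^ k
        + (- of_nat k * inverse x ^ Suc k) * exp (- inverse x)) (at x)"
      by (rule DERIV_mult)
    moreover have "exp (- inverse x) * (inverse x)\<^sup>2 * inverse x ^ k
        + (- of_nat k * inverse x ^ Suc k) * exp (- inverse x)
      = flat_exp (k + 2) x - of_nat k * flat_exp (Suc k) x"
      using 1 by (simp add: flat_exp_def power_add power2_eq_square)
    ultimately have "((\<lambda>x. exp (- inverse x) * inverse x ^ k) has_real_derivative
        flat_exp (k + 2) x - of_nat k * flat_exp (Suc k) x) (at x)"
      by simp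
    then show ?thesis
      by (rule has_field_derivative_transform_within_open[where S="{0<..}"])
         (use 1 in \<open>auto simp: flat_exp_def\<close>)
  next
    case 2
    have "((\<lambda>x. 0) has_real_derivative flat_exp (k + 2) x - of_nat k * flat_exp (Suc k) x) (at x)"
      using 2 by (simp add: flat_exp_def)
    then show ?thesis
      by (rule has_field_derivative_transform_within_open[where S="{..<0}"])
         (use 2 in \<open>auto simp: flat_exp_def\<close>)
  next
    case 3
    \<comment> \<open>The difference quotient at 0 is \<open>flat_exp (Suc k)\<close> on the right,
      which is why the limit at 0 was shown for every index; on the left it is constantly 0.\<close>
    have "((\<lambda>h. flat_exp k h / h) \<longlongrightarrow> 0) (at_right 0)"
    proof (rule Lim_transform_eventually[OF flat_exp_tendsto_0[of "Suc k"]])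
      show "\<forall>\<^sub>F x in at_right 0. flat_exp (Suc k) x = flat_exp k x / x"
        by (auto simp: eventually_at_filter flat_exp_def field_simps)
    qed
    moreover have "((\<lambda>h. flat_exp k h / h) \<longlongrightarrow> 0) (at_left 0)"
      by (rule Lim_transform_eventually[OF tendsto_const])
         (auto simp: eventually_at_filter flat_exp_def)
    ultimately have "((\<lambda>h. flat_exp k h / h) \<longlongrightarrow> 0) (at 0)"
      by (simp add: filterlim_split_at)
    then show ?thesis using 3 by (simp add: DERIV_def flat_exp_def)
  qed
qed

lemma Cn_flat_exp: "Cn m (flat_exp k)"
proof (induction m arbitrary: k)
  case 0
  show ?case using continuous_on_UNIV_if_DERIV[OF flat_exp_has_derivative] by simp
next
  case (Suc m)
  have "Cn m (\<lambda>x. flat_exp (k + 2) x + - of_nat k * flat_exp (Suc k) x)"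
    by (intro Cn_add Cn_mult Cn_const Suc.IH)
  then have "Cn m (\<lambda>x. flat_exp (k + 2) x - of_nat k * flat_exp (Suc k) x)"
    by simp
  then show ?case
    by (rule Cn_SucI[OF flat_exp_has_derivative])
qed

lemma flat_exp_bounds: "0 \<le> flat_exp 0 x" "flat_exp 0 x \<le> 1"
  by (auto simp: flat_exp_def)

text \<open>A smooth approximation of the indicator of \<open>{0<..<1}\<close>, supported in \<open>{1/n..1-1/n}\<close>.\<close>

definition bump :: "nat \<Rightarrow> real \<Rightarrow> real" where
  "bump n t = flat_exp 0 (real n * t - 1) * flat_exp 0 (real n * (1 - t) - 1)"

lemma Cn_bump: "Cn k (bump n)"
proof -
  have "Cn k (\<lambda>t. flat_exp 0 (real n * t + -1) * flat_exp 0 (- real n * t + (real n - 1)))"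
    by (intro Cn_mult Cn_affine Cn_flat_exp)
  also have "(\<lambda>t. flat_exp 0 (real n * t + -1) * flat_exp 0 (- real n * t + (real n - 1))) = bump n"
    by (auto simp: bump_def algebra_simps)
  finally show ?thesis .
qed

lemma bump_bounds: "0 \<le> bump n t" "bump n t \<le> 1"
  using flat_exp_bounds by (auto simp: bump_def mult_le_one)

lemma bump_eq_0:
  assumes "n > 0" "t \<le> 1 / real n \<or> t \<ge> 1 - 1 / real n"
  shows "bump n t = 0"
proof -
  have "real n * t \<le> 1 \<or> real n * (1 - t) \<le> 1"
    using assms by (auto simp: field_simps)
  then show ?thesis by (auto simp: bump_def flat_exp_def)
qed

text \<open>For 0 < t < 1 both arguments of \<open>flat_exp 0\<close> tend to infinity, where
  exp(-1/x) tends to 1. For other t the bump vanishes for every n, so the limit is the indicator of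
  the open interval at every point, not just almost everywhere.\<close>

lemma bump_tendsto: "(\<lambda>n. bump (Suc n) t) \<longlonglongrightarrow> indicator {0<..<1} t"
proof (cases "0 < t \<and> t < 1")
  case True
  have *: "(\<lambda>n. flat_exp 0 (real (Suc n) * s - 1)) \<longlonglongrightarrow> 1" if "s > 0" for s
  proof -
    have lim: "filterlim (\<lambda>n. real (Suc n) * s - 1) at_top sequentially"
      using that by real_asymp
    have "((\<lambda>x. exp (- inverse x)) \<longlongrightarrow> exp (- 0)) (at_top :: real filter)"
      by (intro tendsto_intros tendsto_inverse_0_at_top filterlim_ident)
    moreover have "\<forall>\<^sub>F x in at_top. exp (- inverse x) = flat_exp 0 x"
      using eventually_gt_at_top[of 0] by eventually_elim (simp add: flat_exp_def)
    ultimately have "(flat_exp 0 \<longlongrightarrow> 1) at_top"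
      using Lim_transform_eventually by fastforce
    then show ?thesis by (rule filterlim_compose[OF _ lim])
  qed
  show ?thesis
    using tendsto_mult[OF *[of t] *[of "1 - t"]] True by (simp add: bump_def)
next
  case False
  then have "bump (Suc n) t = 0" for n
  proof (intro bump_eq_0)
    have "t \<le> 0 \<Longrightarrow> t \<le> 1 / real (Suc n)" "t \<ge> 1 \<Longrightarrow> t \<ge> 1 - 1 / real (Suc n)"
      using divide_nonneg_nonneg[of 1 "real (Suc n)"] by linarith+
    with False show "t \<le> 1 / real (Suc n) \<or> 1 - 1 / real (Suc n) \<le> t" by linarith
  qed simp
  with False show ?thesis by simp
qed

text \<open>A smooth step: 0 to the left of the support of \<open>bump n\<close>, constant to the
  right of it. The plateau is not normalised to 1, because differences of rescaled copies are taken
  and the plateaus cancel there. For x < 0 the interval is empty and the value 0 is the correct one,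
  as the bump vanishes there.\<close>

definition bump_integral :: "nat \<Rightarrow> real \<Rightarrow> real" where
  "bump_integral n x = integral {0..x} (bump n)"

lemma continuous_on_bump: "continuous_on S (bump n)"
  using Cn_bump[of 0 n] by (auto intro: continuous_on_subset)

lemma bump_integral_eq_0:
  assumes "n > 0" "t \<le> 1 / real n"
  shows "bump_integral n t = 0"
proof -
  have "integral {0..t} (bump n) = integral {0..t} (\<lambda>x. 0)"
    using assms by (intro integral_cong bump_eq_0) auto
  then show ?thesis by (simp add: bump_integral_def)
qed

lemma bump_integral_eq_const:
  assumes "n > 0" "t \<ge> 1 - 1 / real n"
  shows "bump_integral n t = bump_integral n 1"
proof -
  have *: "bump_integral n s = bump_integral n (1 - 1 / real n)" if "s \<ge> 1 - 1 / real n" for s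
  proof -
    have "integral {1 - 1 / real n..s} (bump n) = integral {1 - 1 / real n..s} (\<lambda>x. 0)"
      using assms by (intro integral_cong bump_eq_0) auto
    moreover have "integral {0..1 - 1 / real n} (bump n) + integral {1 - 1 / real n..s} (bump n)
        = integral {0..s} (bump n)"
      using that assms(1)
      by (intro Henstock_Kurzweil_Integration.integral_combine integrable_continuous_interval
          continuous_on_bump) auto
    ultimately show ?thesis by (simp add: bump_integral_def)
  qed
  show ?thesis using *[OF assms(2)] *[of 1] by simp
qed

lemma bump_integral_has_derivative:
  assumes "n > 0"
  shows "(bump_integral n has_real_derivative bump n x) (at x)"
\<comment> \<open>Left of 1/n the function is locally 0. This takes care of x \<le> 0, where the
  fundamental theorem on an interval starting at 0 gives no two-sided derivative; otherwise x is an
  interior point of \<open>{0..x + 1}\<close>.\<close>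
proof (cases "x < 1 / real n")
  case True
  have "((\<lambda>x. 0) has_real_derivative bump n x) (at x)"
    using True assms by (simp add: bump_eq_0)
  then show ?thesis
    by (rule has_field_derivative_transform_within_open[where S="{..<1 / real n}"])
       (use True assms in \<open>auto simp: bump_integral_eq_0\<close>)
next
  case False
  then have "x > 0" using assms by (auto simp: not_less intro: less_le_trans[rotated])
  have "((\<lambda>u. integral {0..u} (bump n)) has_real_derivative bump n x) (at x within {0..x + 1})"
    using \<open>x > 0\<close> by (intro integral_has_real_derivative continuous_on_bump) auto
  moreover have "at x within {0..x + 1} = at x"
    using \<open>x > 0\<close> by (intro at_within_interior) auto
  ultimately show ?thesis unfolding bump_integral_def by simp
qed

lemma Cn_bump_integral: "n > 0 \<Longrightarrow> Cn k (bump_integral n)"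
  by (rule Cn_SucD, rule Cn_SucI[OF bump_integral_has_derivative Cn_bump])

lemma bump_integral_bounds: "0 \<le> bump_integral n t" "n > 0 \<Longrightarrow> bump_integral n t \<le> 1"
proof -
  show "0 \<le> bump_integral n t"
    unfolding bump_integral_def by (intro integral_nonneg integrable_continuous_interval
        continuous_on_bump bump_bounds)
  assume n: "n > 0"
  have *: "bump_integral n s \<le> 1" if "0 \<le> s" "s \<le> 1" for s
  proof -
    have "integral {0..s} (bump n) \<le> integral {0..s} (\<lambda>x. 1)"
      by (intro integral_le integrable_continuous_interval continuous_on_bump
          continuous_on_const bump_bounds)
    with that show ?thesis by (simp add: bump_integral_def)
  qed
  consider "t \<le> 0" | "0 \<le> t" "t \<le> 1" | "1 \<le> t" by linarith
  then show "bump_integral n t \<le> 1"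
  proof cases
    case 1
    have "0 \<le> 1 / real n" by simp
    with 1 have "t \<le> 1 / real n" by (rule order_trans)
    with n show ?thesis by (simp add: bump_integral_eq_0)
  next
    case 3
    have "0 \<le> 1 / real n" by simp
    with 3 have "t \<ge> 1 - 1 / real n" by linarith
    with n show ?thesis using *[of 1] bump_integral_eq_const[of n t] by simp
  qed (use * in auto)
qed

section \<open>Smooth functions of product form on the plane\<close>

lemma has_derivative_product2:
  assumes "\<And>t. (A has_real_derivative A' t) (at t)" "\<And>t. (B has_real_derivative B' t) (at t)"
  shows "((\<lambda>x::real^2. A (x $ 1) * B (x $ 2)) has_derivative
    (\<lambda>v. A (x $ 1) * (B' (x $ 2) * v $ 2) + A' (x $ 1) * v $ 1 * B (x $ 2))) (at x)"
proof -
  have comp: "((\<lambda>x::real^2. x $ i) has_derivative (\<lambda>v. v $ i)) (at x)" for i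
    by (rule bounded_linear_imp_has_derivative[OF bounded_linear_vec_nth])
  have "((\<lambda>x::real^2. A (x $ 1)) has_derivative (\<lambda>v. A' (x $ 1) * v $ 1)) (at x)"
    "((\<lambda>x::real^2. B (x $ 2)) has_derivative (\<lambda>v. B' (x $ 2) * v $ 2)) (at x)"
    using has_derivative_compose[OF comp assms(1)[unfolded has_field_derivative_def]]
      has_derivative_compose[OF comp assms(2)[unfolded has_field_derivative_def]] by auto
  from has_derivative_mult[OF this] show ?thesis by simp
qed

lemma partial_product2:
  assumes "\<And>t. (A has_real_derivative A' t) (at t)" "\<And>t. (B has_real_derivative B' t) (at t)"
  shows "partial 1 (\<lambda>x::real^2. A (x $ 1) * B (x $ 2)) = (\<lambda>x. A' (x $ 1) * B (x $ 2))"
    and "partial 2 (\<lambda>x::real^2. A (x $ 1) * B (x $ 2)) = (\<lambda>x. A (x $ 1) * B' (x $ 2))"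
  by (auto simp: partial_def fun_eq_iff axis_def
      frechet_derivative_at[OF has_derivative_product2[OF assms], symmetric])

text \<open>Both partial derivatives of a product of functions of one coordinate each are again such
  products, so the induction closes within this class.\<close>

lemma Ck_product2:
  "Cn k A \<Longrightarrow> Cn k B \<Longrightarrow> Ck k (\<lambda>x::real^2. A (x $ 1) * B (x $ 2))"
proof (induction k arbitrary: A B)
  case 0
  then show ?case
    by (auto intro!: continuous_on_mult continuous_on_compose2[of UNIV A]
        continuous_on_compose2[of UNIV B] continuous_intros)
next
  case (Suc k)
  obtain A' where A: "\<And>x. (A has_real_derivative A' x) (at x)" "Cn k A'"
    using Suc.prems(1) unfolding Cn.simps(2) by blast
  obtain B' where B: "\<And>x. (B has_real_derivative B' x) (at x)" "Cn k B'"
    using Suc.prems(2) unfolding Cn.simps(2) by blast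
  have "(\<lambda>x::real^2. A (x $ 1) * B (x $ 2)) differentiable_on UNIV"
    using has_derivative_product2[OF A(1) B(1)] differentiableI
    by (auto simp: differentiable_on_def intro: differentiable_at_withinI)
  moreover have "Ck k (partial i (\<lambda>x::real^2. A (x $ 1) * B (x $ 2)))" for i
  proof -
    have "i = 1 \<or> i = 2" using exhaust_2 by blast
    then show ?thesis
      using Suc.IH[OF A(2) Suc.prems(2)[THEN Cn_SucD]] Suc.IH[OF Suc.prems(1)[THEN Cn_SucD] B(2)]
        partial_product2[OF A(1) B(1)] by auto
  qed
  ultimately show ?case by simp
qed

section \<open>Mean values over rectangles\<close>

definition rect :: "real \<Rightarrow> real \<Rightarrow> real \<Rightarrow> real \<Rightarrow> (real^2) set" where
  "rect p q c d = {x. p \<le> x $ 1 \<and> x $ 1 \<le> q \<and> c \<le> x $ 2 \<and> x $ 2 \<le> d}"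

lemma rect_eq_cbox: "rect p q c d = cbox (vector [p, c]) (vector [q, d])"
  by (auto simp: rect_def mem_box_cart forall_2)

lemma Q_eq_rect: "Q = rect (-1) 1 (-1) 1"
  by (auto simp: Q_def rect_def mem_box_cart forall_2)

lemma interior_Q: "interior Q = {x. -1 < x $ 1 \<and> x $ 1 < 1 \<and> -1 < x $ 2 \<and> x $ 2 < 1}"
  by (auto simp: Q_def mem_box_cart forall_2)

lemma content_rect: "p \<le> q \<Longrightarrow> c \<le> d \<Longrightarrow> measure lborel (rect p q c d) = (q - p) * (d - c)"
  unfolding rect_eq_cbox
  by (subst content_cbox_cart) (auto simp: UNIV_2 interval_ne_empty_cart(1) forall_2)

lemma Q_lebesgue [simp]: "Q \<in> sets lebesgue"
  by (simp add: Q_def)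

lemma finite_measure_Q: "finite_measure (lebesgue_on Q)"
  by (rule finite_measure_lebesgue_on) (simp add: Q_def lmeasurable_cbox)

text \<open>\<open>Q\<close> has finite measure, and (|f| - 1)^2 \<ge> 0 makes 1 + |f|^2 an
  integrable majorant of |f|.\<close>

lemma L2_imp_integrable:
  fixes f :: "real^2 \<Rightarrow> 'b::euclidean_space"
  assumes "f \<in> L2 Q"
  shows "integrable (lebesgue_on Q) f"
proof (rule Bochner_Integration.integrable_bound)
  interpret finite_measure "lebesgue_on Q" by (rule finite_measure_Q)
  show "integrable (lebesgue_on Q) (\<lambda>x. 1 + (norm (f x))\<^sup>2)"
    using assms by (auto simp: L2_def)
  have "norm (f x) \<le> 1 + (norm (f x))\<^sup>2" for x
    using zero_le_power2[of "norm (f x) - 1"] norm_ge_zero[of "f x"]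
    unfolding power2_diff by (simp del: norm_ge_zero zero_le_power2)
  then show "AE x in lebesgue_on Q. norm (f x) \<le> norm (1 + (norm (f x))\<^sup>2)"
    by (auto intro!: AE_I2 order_trans[OF _ abs_ge_self])
qed (use assms in \<open>simp add: L2_def\<close>)

text \<open>The bridge between two integrals: weak derivatives are stated with the Bochner integral
  over \<open>Q\<close>, whereas substitution and the differentiation theorem are applied to gauge
  integrals over subrectangles.\<close>

lemma integral_rect_restrict:
  fixes f :: "real^2 \<Rightarrow> real"
  assumes f: "integrable (lebesgue_on Q) f" and sub: "rect p q c d \<subseteq> Q"
  shows "integrable (lebesgue_on Q) (\<lambda>x. indicator (rect p q c d) x * f x)"
    and "(\<integral>x. indicator (rect p q c d) x * f x \<partial>lebesgue_on Q) = integral (rect p q c d) f"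
    and "f integrable_on rect p q c d"
proof -
  show *: "integrable (lebesgue_on Q) (\<lambda>x. indicator (rect p q c d) x * f x)"
    using integrable_mult_indicator[OF _ f, of "rect p q c d"] sub
    by (auto simp: rect_eq_cbox sets_restrict_space_iff)
  have "(\<integral>x. indicator (rect p q c d) x * f x \<partial>lebesgue_on Q)
      = integral Q (\<lambda>x. indicator (rect p q c d) x * f x)"
    by (rule lebesgue_integral_eq_integral[OF * Q_lebesgue])
  also have "\<dots> = integral Q (\<lambda>x. if x \<in> rect p q c d then f x else 0)"
    by (intro integral_cong) (auto simp: indicator_def)
  also have "\<dots> = integral (Q \<inter> rect p q c d) f"
    by (simp add: integral_restrict_Int Int_commute)
  finally show "(\<integral>x. indicator (rect p q c d) x * f x \<partial>lebesgue_on Q) = integral (rect p q c d) f"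
    using sub by (simp add: Int_absorb1)
  have "f integrable_on Q"
    using f by (intro integrable_on_lebesgue_on) auto
  then show "f integrable_on rect p q c d"
    using sub unfolding Q_def rect_eq_cbox by (rule integrable_on_subcbox)
qed

section \<open>Null sets and the limits of rescaled bumps\<close>

lemma AE_lebesgue_on_negligible:
  assumes "negligible N"
  shows "AE x in lebesgue_on Q. x \<notin> N"
proof -
  have "AE x in lebesgue. x \<notin> N"
    using assms by (intro AE_not_in) (simp add: negligible_iff_null_sets)
  then show ?thesis
    by (subst AE_restrict_space_iff) (auto elim: AE_mp)
qed

lemma indicator_rescale:
  "v > u \<Longrightarrow> indicator {0<..<1} ((t - u) / (v - u)) = (indicator {u<..<v} t :: real)" for u v t :: real
  by (simp add: indicator_def field_simps)

text \<open>The bumps converge to indicators of open intervals while \<open>rect\<close> is closed;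
  the two sides differ on the frontier of a rectangle, which is a null set.\<close>

lemma indicator_product_eq_rect_AE:
  assumes "p < q" "c < d"
  shows "AE x in lebesgue_on Q. indicator {0<..<1} ((x $ 1 - p) / (q - p)) *
    indicator {0<..<1} ((x $ 2 - c) / (d - c)) = (indicator (rect p q c d) x :: real)"
proof -
  have "AE x in lebesgue_on Q. x \<notin> rect p q c d - box (vector [p, c]) (vector [q, d])"
    unfolding rect_eq_cbox by (intro AE_lebesgue_on_negligible negligible_frontier_interval)
  then show ?thesis
  proof eventually_elim
    case (elim x)
    then show ?case
      unfolding indicator_rescale[OF assms(1)] indicator_rescale[OF assms(2)]
      by (auto simp: indicator_def rect_def mem_box_cart forall_2)
  qed
qed

text \<open>The test function is a cut-off in x1 times a difference of two smooth steps in x2. Its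
  derivative in x2 tends to the difference of the indicators of the two rectangles, each divided by
  its height, while the function itself is dominated by the indicator of the surrounding rectangle.
  Only heights are divided out here; the common width q - p stays in both integrals.\<close>

lemma weak_partial_average_diff:
  assumes wp: "has_weak_partial Q 2 y (G :: real^2 \<Rightarrow> real)"
    and pq: "-1 \<le> p" "p < q" "q \<le> 1"
    and H: "-1 \<le> a" "b \<le> 1"
    and cd: "a \<le> c" "c < d" "d \<le> b"
    and cd': "a \<le> c'" "c' < d'" "d' \<le> b"
  shows "\<bar>integral (rect p q c d) y / (d - c) - integral (rect p q c' d') y / (d' - c')\<bar>
    \<le> integral (rect p q a b) (\<lambda>x. \<bar>G x\<bar>)"
proof -
  have y: "integrable (lebesgue_on Q) y" and G: "integrable (lebesgue_on Q) G"
    using wp L2_imp_integrable by (auto simp: has_weak_partial_def)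
  define A where "A n t = bump (Suc n) ((t - p) / (q - p))" for n t
  \<comment> \<open>Antiderivatives of the bumps rescaled to [c,d] and [c',d']. The chain rule
    produces the factors 1/(d - c) and 1/(d' - c') in \<open>J\<close> and \<open>J'\<close>, which
    are the normalisation in the claim.\<close>
  define I where "I n t = bump_integral (Suc n) ((t - c) / (d - c))" for n t
  define I' where "I' n t = bump_integral (Suc n) ((t - c') / (d' - c'))" for n t
  define J where "J n t = bump (Suc n) ((t - c) / (d - c)) / (d - c)" for n t
  define J' where "J' n t = bump (Suc n) ((t - c') / (d' - c')) / (d' - c')" for n t
  define \<phi> where "\<phi> n x = A n (x $ 1) * (I n (x $ 2) - I' n (x $ 2))" for n and x :: "real^2"
  have affine: "Cn k (\<lambda>t. f ((t - u) / v))" if "Cn k f" for k f and u v :: real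
    using Cn_affine[OF that, of "1 / v" "- u / v"] by (simp add: diff_divide_distrib)
  have A: "Cn k (A n)" and I: "Cn k (I n)" and I': "Cn k (I' n)" for k n
    unfolding A_def I_def I'_def by (intro affine Cn_bump Cn_bump_integral; simp)+
  have II': "Cn k (\<lambda>t. I n t - I' n t)" for k n
    using Cn_add[OF I[of k n] Cn_mult[OF Cn_const[of k "-1"] I'[of k n]]] by simp
  have deriv: "((\<lambda>t. bump_integral (Suc n) ((t - u) / v)) has_real_derivative
      bump (Suc n) ((t - u) / v) / v) (at t)" if "v > 0" for n t u v
  proof -
    have "((\<lambda>t. (t - u) / v) has_real_derivative 1 / v) (at t)"
      using that by (auto intro!: derivative_eq_intros)
    from DERIV_chain2[OF bump_integral_has_derivative this, of "Suc n"] show ?thesis by simp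
  qed
  have dII': "((\<lambda>t. I n t - I' n t) has_real_derivative J n t - J' n t) (at t)" for n t
    unfolding I_def I'_def J_def J'_def using cd cd' by (intro DERIV_diff deriv) auto
  \<comment> \<open>Differentiability of \<open>A n\<close> makes the product differentiable; the
    partial derivative in direction 2 leaves \<open>A n\<close> as it is, so no formula for
    \<open>A'\<close> is required.\<close>
  obtain A' where "\<And>n t. (A n has_real_derivative A' n t) (at t)"
    using A[of "Suc 0"] unfolding Cn.simps by metis
  from partial_product2(2)[OF this dII']
  have partial: "partial 2 (\<phi> n) = (\<lambda>x. A n (x $ 1) * (J n (x $ 2) - J' n (x $ 2)))" for n
    unfolding \<phi>_def .
  \<comment> \<open>\<open>bump (Suc n)\<close> vanishes within 1/(n+1) of the ends of the unit
    interval. Rescaled, this gives the margins that keep the support off the boundary of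
    \<open>Q\<close>; the minimum serves both intervals at once.\<close>
  define \<delta> where "\<delta> n = (q - p) / real (Suc n)" for n
  define \<epsilon> where "\<epsilon> n = min (d - c) (d' - c') / real (Suc n)" for n
  have pos: "\<delta> n > 0" "\<epsilon> n > 0" for n
    using pq cd cd' by (simp_all add: \<delta>_def \<epsilon>_def)
  have A_eq_0: "A n t = 0" if "t < p + \<delta> n \<or> t > q - \<delta> n" for n t
    unfolding A_def using that[unfolded \<delta>_def] pq by (intro bump_eq_0) (auto simp: field_simps)
  \<comment> \<open>Near a both steps are 0, near b both have reached the same plateau
    \<open>bump_integral (Suc n) 1\<close>. This cancellation is what makes the test function
    compactly supported in x2.\<close>
  have II'_eq_0: "I n t - I' n t = 0"
    if "t < a + \<epsilon> n \<or> t > b - \<epsilon> n" for n t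
  proof -
    have m: "\<epsilon> n \<le> (d - c) / Suc n" "\<epsilon> n \<le> (d' - c') / Suc n"
      unfolding \<epsilon>_def by (auto intro: divide_right_mono)
    from that show ?thesis
    proof
      assume "t < a + \<epsilon> n"
      with m cd cd' have "t - c \<le> (d - c) / Suc n" "t - c' \<le> (d' - c') / Suc n" by linarith+
      then have "(t - c) / (d - c) \<le> 1 / Suc n" "(t - c') / (d' - c') \<le> 1 / Suc n"
        using cd cd' by (auto simp: field_simps)
      then show ?thesis unfolding I_def I'_def by (simp add: bump_integral_eq_0 del: of_nat_Suc)
    next
      assume "t > b - \<epsilon> n"
      with m cd cd' have "t - c \<ge> (d - c) - (d - c) / Suc n" "t - c' \<ge> (d' - c') - (d' - c') / Suc n"
        by linarith+
      then have "(t - c) / (d - c) \<ge> 1 - 1 / Suc n" "(t - c') / (d' - c') \<ge> 1 - 1 / Suc n"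
        using cd cd' by (auto simp: field_simps)
      then show ?thesis unfolding I_def I'_def
        using bump_integral_eq_const[of "Suc n" "(t - c) / (d - c)"]
          bump_integral_eq_const[of "Suc n" "(t - c') / (d' - c')"] by simp
    qed
  qed
  have test: "\<phi> n \<in> test_functions Q" for n
  proof -
    define K where "K = rect (p + \<delta> n) (q - \<delta> n) (a + \<epsilon> n) (b - \<epsilon> n)"
    have "K \<subseteq> interior Q"
      using pos[of n] pq H unfolding K_def interior_Q rect_def by auto
    moreover have "\<phi> n x = 0" if "x \<notin> K" for x
    proof -
      have "(x $ 1 < p + \<delta> n \<or> x $ 1 > q - \<delta> n) \<or> (x $ 2 < a + \<epsilon> n \<or> x $ 2 > b - \<epsilon> n)"
        using that unfolding K_def rect_def mem_Collect_eq by linarith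
      then show ?thesis
        using A_eq_0[of "x $ 1" n] II'_eq_0[of "x $ 2" n] unfolding \<phi>_def
        by (metis mult_zero_left mult_zero_right)
    qed
    moreover have "Ck k (\<phi> n)" for k
      unfolding \<phi>_def by (rule Ck_product2[OF A II'])
    moreover have "compact K" unfolding K_def rect_eq_cbox by simp
    ultimately show ?thesis unfolding test_functions_def by blast
  qed
  have A01: "0 \<le> A n t" "A n t \<le> 1" for n t
    by (auto simp: A_def bump_bounds)
  have sub: "rect p q a b \<subseteq> Q" "rect p q c d \<subseteq> Q" "rect p q c' d' \<subseteq> Q"
    using pq H cd cd' by (auto simp: rect_def Q_eq_rect)
  \<comment> \<open>Both steps take values in [0,1], so their difference is at most 1 in absolute
    value and no factor 2 arises.\<close>
  have bound: "\<bar>\<phi> n x\<bar> \<le> indicator (rect p q a b) x" for n x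
  proof (cases "x \<in> rect p q a b")
    case True
    have "0 \<le> I n (x $ 2)" "I n (x $ 2) \<le> 1" "0 \<le> I' n (x $ 2)" "I' n (x $ 2) \<le> 1"
      unfolding I_def I'_def by (auto intro: bump_integral_bounds)
    then have "\<bar>I n (x $ 2) - I' n (x $ 2)\<bar> \<le> 1" by linarith
    then show ?thesis using True A01 by (auto simp: \<phi>_def abs_mult intro: mult_le_one)
  next
    case False
    have "(x $ 1 < p + \<delta> n \<or> x $ 1 > q - \<delta> n) \<or> (x $ 2 < a + \<epsilon> n \<or> x $ 2 > b - \<epsilon> n)"
      using False pos[of n] unfolding rect_def mem_Collect_eq by linarith
    then have "A n (x $ 1) = 0 \<or> I n (x $ 2) - I' n (x $ 2) = 0"
      using A_eq_0[of "x $ 1" n] II'_eq_0[of "x $ 2" n] by blast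
    then show ?thesis by (auto simp: \<phi>_def)
  qed
  have le: "\<bar>\<integral>x. partial 2 (\<phi> n) x * y x \<partial>lebesgue_on Q\<bar> \<le> integral (rect p q a b) (\<lambda>x. \<bar>G x\<bar>)" for n
  proof -
    have "(\<integral>x. partial 2 (\<phi> n) x * y x \<partial>lebesgue_on Q) = - (\<integral>x. \<phi> n x * G x \<partial>lebesgue_on Q)"
      using wp test[of n] by (simp add: has_weak_partial_def)
    then have "\<bar>\<integral>x. partial 2 (\<phi> n) x * y x \<partial>lebesgue_on Q\<bar> = \<bar>\<integral>x. \<phi> n x * G x \<partial>lebesgue_on Q\<bar>"
      by simp
    also have "\<dots> \<le> (\<integral>x. \<bar>\<phi> n x * G x\<bar> \<partial>lebesgue_on Q)"
      by (rule integral_abs_bound)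
    also have "\<dots> \<le> (\<integral>x. indicator (rect p q a b) x * \<bar>G x\<bar> \<partial>lebesgue_on Q)"
    proof (rule integral_mono')
      show "integrable (lebesgue_on Q) (\<lambda>x. indicator (rect p q a b) x * \<bar>G x\<bar>)"
        using integral_rect_restrict(1)[OF integrable_abs[OF G] sub(1)] .
      show "\<bar>\<phi> n x * G x\<bar> \<le> indicator (rect p q a b) x * \<bar>G x\<bar>" for x
        unfolding abs_mult by (intro mult_right_mono bound) simp
    qed simp
    also have "\<dots> = integral (rect p q a b) (\<lambda>x. \<bar>G x\<bar>)"
      using integral_rect_restrict(2)[OF integrable_abs[OF G] sub(1)] .
    finally show ?thesis .
  qed
  let ?L = "\<lambda>x. indicator (rect p q c d) x * y x / (d - c) - indicator (rect p q c' d') x * y x / (d' - c')"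
  have lim: "(\<lambda>n. \<integral>x. partial 2 (\<phi> n) x * y x \<partial>lebesgue_on Q) \<longlonglongrightarrow> (\<integral>x. ?L x \<partial>lebesgue_on Q)"
  proof (rule integral_dominated_convergence)
    \<comment> \<open>The bounds \<open>A n\<close> \<le> 1, \<open>J n\<close> \<le> 1/(d - c) and
      \<open>J' n\<close> \<le> 1/(d' - c') do not depend on n, so a fixed multiple of |y|
      dominates.\<close>
    show "integrable (lebesgue_on Q) (\<lambda>x. (1 / (d - c) + 1 / (d' - c')) * \<bar>y x\<bar>)"
      using y by simp
    show "?L \<in> borel_measurable (lebesgue_on Q)"
      using integral_rect_restrict(1)[OF y sub(2)] integral_rect_restrict(1)[OF y sub(3)]
      by (intro borel_measurable_integrable) auto
    have cont: "continuous_on UNIV (\<lambda>x::real^2. A n (x $ 1) * (J n (x $ 2) - J' n (x $ 2)))" for n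
      unfolding A_def J_def J'_def using pq cd cd'
      by (intro continuous_intros continuous_on_compose2[OF continuous_on_bump[of UNIV]]) auto
    have "(\<lambda>x::real^2. A n (x $ 1) * (J n (x $ 2) - J' n (x $ 2))) \<in> borel_measurable (lebesgue_on Q)" for n
      by (rule continuous_imp_measurable_on_sets_lebesgue[OF continuous_on_subset[OF cont]]) auto
    then show "(\<lambda>x. partial 2 (\<phi> n) x * y x) \<in> borel_measurable (lebesgue_on Q)" for n
      unfolding partial by (rule borel_measurable_times[OF _ borel_measurable_integrable[OF y]])
    show "AE x in lebesgue_on Q. norm (partial 2 (\<phi> n) x * y x) \<le> (1 / (d - c) + 1 / (d' - c')) * \<bar>y x\<bar>" for n
    proof (rule AE_I2)
      fix x :: "real^2"
      have "0 \<le> J n (x $ 2)" "J n (x $ 2) \<le> 1 / (d - c)" "0 \<le> J' n (x $ 2)" "J' n (x $ 2) \<le> 1 / (d' - c')"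
        unfolding J_def J'_def using cd cd' by (auto intro!: divide_right_mono simp: bump_bounds)
      then have J: "\<bar>J n (x $ 2) - J' n (x $ 2)\<bar> \<le> 1 / (d - c) + 1 / (d' - c')" by linarith
      have "\<bar>A n (x $ 1) * (J n (x $ 2) - J' n (x $ 2))\<bar> \<le> 1 * (1 / (d - c) + 1 / (d' - c'))"
        unfolding abs_mult by (intro mult_mono J) (use A01 in auto)
      then show "norm (partial 2 (\<phi> n) x * y x) \<le> (1 / (d - c) + 1 / (d' - c')) * \<bar>y x\<bar>"
        unfolding partial real_norm_def abs_mult by (intro mult_right_mono) auto
    qed
    have "AE x in lebesgue_on Q. indicator {0<..<1} ((x $ 1 - p) / (q - p)) *
        indicator {0<..<1} ((x $ 2 - c) / (d - c)) = (indicator (rect p q c d) x :: real)"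
      "AE x in lebesgue_on Q. indicator {0<..<1} ((x $ 1 - p) / (q - p)) *
        indicator {0<..<1} ((x $ 2 - c') / (d' - c')) = (indicator (rect p q c' d') x :: real)"
      using pq cd cd' by (auto intro: indicator_product_eq_rect_AE)
    then show "AE x in lebesgue_on Q. (\<lambda>n. partial 2 (\<phi> n) x * y x) \<longlonglongrightarrow> ?L x"
    proof eventually_elim
      case (elim x)
      have "(\<lambda>n. partial 2 (\<phi> n) x * y x) \<longlonglongrightarrow> indicator {0<..<1} ((x $ 1 - p) / (q - p)) *
        (indicator {0<..<1} ((x $ 2 - c) / (d - c)) / (d - c)
          - indicator {0<..<1} ((x $ 2 - c') / (d' - c')) / (d' - c')) * y x"
        unfolding partial A_def J_def J'_def
        using cd cd' by (intro tendsto_intros bump_tendsto) auto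
      also have "indicator {0<..<1} ((x $ 1 - p) / (q - p)) *
        (indicator {0<..<1} ((x $ 2 - c) / (d - c)) / (d - c)
          - indicator {0<..<1} ((x $ 2 - c') / (d' - c')) / (d' - c')) * y x = ?L x"
        unfolding elim[symmetric] by (simp add: algebra_simps)
      finally show ?case .
    qed
  qed
  have "(\<integral>x. ?L x \<partial>lebesgue_on Q)
      = integral (rect p q c d) y / (d - c) - integral (rect p q c' d') y / (d' - c')"
    using integral_rect_restrict[OF y sub(2)] integral_rect_restrict[OF y sub(3)] by simp
  moreover have "\<bar>\<integral>x. ?L x \<partial>lebesgue_on Q\<bar> \<le> integral (rect p q a b) (\<lambda>x. \<bar>G x\<bar>)"
    by (rule LIMSEQ_le_const2[OF tendsto_rabs[OF lim]]) (use le in auto)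
  ultimately show ?thesis by simp
qed

text \<open>Young's inequality |G| \<le> (s + G^2/s)/2, that is (s - |G|)^2 \<ge> 0, is integrated
  in place of Cauchy-Schwarz. The weight s is chosen once the rectangle is known, and no square root
  appears.\<close>

lemma integral_abs_rect_le:
  assumes G: "G \<in> L2 Q" and pq: "-1 \<le> p" "p \<le> q" "q \<le> 1" and ab: "-1 \<le> a" "a \<le> b" "b \<le> 1"
    and s: "s > 0"
  shows "integral (rect p q a b) (\<lambda>x. \<bar>G x :: real\<bar>)
    \<le> (s * ((q - p) * (b - a)) + (\<integral>x. (G x)\<^sup>2 \<partial>lebesgue_on Q) / s) / 2"
proof -
  have sub: "rect p q a b \<subseteq> Q"
    using pq ab by (auto simp: rect_def Q_eq_rect)
  have G2: "integrable (lebesgue_on Q) (\<lambda>x. (G x)\<^sup>2)"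
    using G by (simp add: L2_def)
  have one: "integrable (lebesgue_on Q) (\<lambda>x. 1::real)"
    using finite_measure.integrable_const[OF finite_measure_Q] .
  note ind = integral_rect_restrict[OF one sub]
  have "integral (rect p q a b) (\<lambda>x. \<bar>G x\<bar>) = (\<integral>x. indicator (rect p q a b) x * \<bar>G x\<bar> \<partial>lebesgue_on Q)"
    using integral_rect_restrict(2)[OF integrable_abs[OF L2_imp_integrable[OF G]] sub] by simp
  also have "\<dots> \<le> (\<integral>x. (s * (indicator (rect p q a b) x * 1) + (G x)\<^sup>2 / s) / 2 \<partial>lebesgue_on Q)"
  proof (rule integral_mono')
    show "integrable (lebesgue_on Q) (\<lambda>x. (s * (indicator (rect p q a b) x * 1) + (G x)\<^sup>2 / s) / 2)"
      using ind(1) G2 by simp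
    fix x
    have "0 \<le> (s - \<bar>G x\<bar>)\<^sup>2 / s" using s by simp
    also have "\<dots> = s - 2 * \<bar>G x\<bar> + (G x)\<^sup>2 / s"
      using s by (simp add: power2_eq_square field_simps)
    finally show "indicator (rect p q a b) x * \<bar>G x\<bar> \<le> (s * (indicator (rect p q a b) x * 1) + (G x)\<^sup>2 / s) / 2"
      using s by (auto simp: indicator_def)
  qed (use s in auto)
  also have "\<dots> = (s * integral (rect p q a b) (\<lambda>x. 1) + (\<integral>x. (G x)\<^sup>2 \<partial>lebesgue_on Q) / s) / 2"
    using ind(1,2) G2 by simp
  also have "integral (rect p q a b) (\<lambda>x. 1) = (q - p) * (b - a)"
    using content_rect[OF pq(2) ab(2)] unfolding rect_eq_cbox by simp
  finally show ?thesis .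
qed

text \<open>An affine map \<open>T\<close> of the first coordinate carries the narrow rectangle onto
  the wide one, so the mean of y over the wide rectangle is the mean of y o \<open>T\<close> over
  the narrow one. The points x and \<open>T x\<close> lie on one horizontal line at distance at most
  q - p, hence the integrands differ by at most M (q - p). Heights are not divided out, which leaves
  the factor d - c.\<close>

lemma Lipschitz_average_diff:
  fixes y :: "real^2 \<Rightarrow> real"
  assumes y: "y integrable_on rect p q c d"
    and Lip: "\<And>x z. x \<in> rect p q c d \<Longrightarrow> z \<in> rect p q c d \<Longrightarrow> x $ 2 = z $ 2 \<Longrightarrow> \<bar>y x - y z\<bar> \<le> M * \<bar>x $ 1 - z $ 1\<bar>"
    and pq: "p \<le> p0" "p0 < q0" "q0 \<le> q" and cd: "c \<le> d" and M: "M \<ge> 0"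
  shows "\<bar>integral (rect p0 q0 c d) y / (q0 - p0) - integral (rect p q c d) y / (q - p)\<bar>
    \<le> M * (q - p) * (d - c)"
proof -
  define \<kappa> where "\<kappa> = (q - p) / (q0 - p0)"
  \<comment> \<open>With this shift, stretching the first coordinate by \<kappa> and then adding
    \<open>v\<close> is \<open>T\<close>, whose Jacobian is \<kappa>.\<close>
  define v :: "real^2" where "v = vector [p - \<kappa> * p0, 0]"
  define T :: "real^2 \<Rightarrow> real^2" where "T x = vector [p + \<kappa> * (x $ 1 - p0), x $ 2]" for x
  have \<kappa>: "\<kappa> > 0" "\<kappa> * (q0 - p0) = q - p"
    using pq by (auto simp: \<kappa>_def)
  have "(y has_integral integral (rect p q c d) y) (cbox (vector [p, c]) (vector [q, d]))"
    using y by (simp add: rect_eq_cbox integrable_integral)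
  from has_integral_stretch_cart[OF has_integral_shift_cbox[OF this, of v], of "\<lambda>k. if k = 1 then \<kappa> else 1"]
  have "((\<lambda>x. y ((\<chi> k. (if k = 1 then \<kappa> else 1) * x $ k) + v)) has_integral
      integral (rect p q c d) y /\<^sub>R \<bar>\<Prod>k::2\<in>UNIV. if k = 1 then \<kappa> else 1\<bar>)
      ((\<lambda>x. \<chi> k. x $ k / (if k = 1 then \<kappa> else 1)) ` cbox (vector [p, c] - v) (vector [q, d] - v))"
    using \<kappa>(1) by auto
  moreover have "(\<lambda>x::real^2. \<chi> k. x $ k / (if k = 1 then \<kappa> else 1)) ` cbox (vector [p, c] - v) (vector [q, d] - v)
    = rect p0 q0 c d"
  proof (intro set_eqI iffI)
    fix x :: "real^2" assume "x \<in> rect p0 q0 c d"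
    moreover from this have "\<kappa> * p0 \<le> \<kappa> * x $ 1" "\<kappa> * x $ 1 \<le> \<kappa> * q0"
      using \<kappa>(1) by (auto simp: rect_def)
    ultimately have "(\<chi> k. (if k = 1 then \<kappa> else 1) * x $ k) \<in> cbox (vector [p, c] - v) (vector [q, d] - v)"
      using \<kappa>(2) by (auto simp: rect_def v_def mem_box_cart forall_2 algebra_simps)
    then show "x \<in> (\<lambda>x. \<chi> k. x $ k / (if k = 1 then \<kappa> else 1)) ` cbox (vector [p, c] - v) (vector [q, d] - v)"
      by (rule image_eqI[rotated]) (use \<kappa>(1) in \<open>simp add: vec_eq_iff\<close>)
  next
    fix x :: "real^2"
    assume "x \<in> (\<lambda>x. \<chi> k. x $ k / (if k = 1 then \<kappa> else 1)) ` cbox (vector [p, c] - v) (vector [q, d] - v)"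
    then obtain z :: "real^2" where z: "z \<in> cbox (vector [p, c] - v) (vector [q, d] - v)"
      "x = (\<chi> k. z $ k / (if k = 1 then \<kappa> else 1))" by blast
    have "\<kappa> * p0 \<le> z $ 1" "z $ 1 \<le> \<kappa> * q0" "c \<le> z $ 2" "z $ 2 \<le> d"
      using z(1) \<kappa>(2) by (auto simp: v_def mem_box_cart forall_2 algebra_simps)
    then show "x \<in> rect p0 q0 c d"
      using z(2) \<kappa>(1) by (auto simp: rect_def field_simps)
  qed
  moreover have "(\<chi> k. (if k = 1 then \<kappa> else 1) * x $ k) + v = T x" for x :: "real^2"
    by (simp add: vec_eq_iff forall_2 T_def v_def algebra_simps)
  moreover have "(\<Prod>k::2\<in>UNIV. if k = 1 then \<kappa> else 1) = \<kappa>"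
    by (simp add: UNIV_2)
  ultimately have T: "((\<lambda>x. y (T x)) has_integral integral (rect p q c d) y / \<kappa>) (rect p0 q0 c d)"
    using \<kappa>(1) by (simp add: divide_inverse mult.commute)
  have sub: "rect p0 q0 c d \<subseteq> rect p q c d"
    using pq by (auto simp: rect_def)
  have y0: "y integrable_on rect p0 q0 c d"
    using y sub unfolding rect_eq_cbox by (rule integrable_on_subcbox)
  have bound: "norm (y x - y (T x)) \<le> M * (q - p)" if x: "x \<in> rect p0 q0 c d" for x
  proof -
    have "0 \<le> \<kappa> * (x $ 1 - p0)" "\<kappa> * (x $ 1 - p0) \<le> \<kappa> * (q0 - p0)"
      using x \<kappa>(1) by (auto simp: rect_def)
    then have Tx: "T x \<in> rect p q c d"
      using x \<kappa>(2) by (auto simp: rect_def T_def)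
    have "x \<in> rect p q c d" using x sub by blast
    then have "\<bar>y x - y (T x)\<bar> \<le> M * \<bar>x $ 1 - T x $ 1\<bar>"
      using Tx by (rule Lip) (simp add: T_def)
    also have "\<bar>x $ 1 - T x $ 1\<bar> \<le> q - p"
      using Tx \<open>x \<in> rect p q c d\<close> unfolding rect_def mem_Collect_eq by linarith
    finally show ?thesis using M by (simp add: mult_left_mono)
  qed
  have diff: "((\<lambda>x. y x - y (T x)) has_integral
      integral (rect p0 q0 c d) y - integral (rect p q c d) y / \<kappa>) (rect p0 q0 c d)"
    by (intro has_integral_diff T integrable_integral y0)
  have "norm (integral (rect p0 q0 c d) y - integral (rect p q c d) y / \<kappa>)
      \<le> M * (q - p) * measure lborel (rect p0 q0 c d)"
    using diff bound M pq unfolding rect_eq_cbox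
    by (intro has_integral_bound[where f="\<lambda>x. y x - y (T x)"]) auto
  also have "measure lborel (rect p0 q0 c d) = (q0 - p0) * (d - c)"
    using pq cd by (intro content_rect) auto
  finally have *: "\<bar>integral (rect p0 q0 c d) y - integral (rect p q c d) y / \<kappa>\<bar>
      \<le> M * (q - p) * ((q0 - p0) * (d - c))" by simp
  have "\<bar>integral (rect p0 q0 c d) y / (q0 - p0) - integral (rect p q c d) y / (q - p)\<bar>
      = \<bar>integral (rect p0 q0 c d) y - integral (rect p q c d) y / \<kappa>\<bar> / (q0 - p0)"
  proof -
    have "integral (rect p0 q0 c d) y / (q0 - p0) - integral (rect p q c d) y / (q - p)
      = (integral (rect p0 q0 c d) y - integral (rect p q c d) y / \<kappa>) / (q0 - p0)"
      by (simp add: diff_divide_distrib \<kappa>(2))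
    then show ?thesis using pq by simp
  qed
  also have "\<dots> \<le> M * (q - p) * ((q0 - p0) * (d - c)) / (q0 - p0)"
    using * pq by (intro divide_right_mono) auto
  also have "\<dots> = M * (q - p) * (d - c)" using pq by simp
  finally show ?thesis .
qed

text \<open>The differentiation theorem, for squares with \<open>x\<close> as lower left corner, is
  applied to the extension of \<open>y\<close> by 0. For interior x and small h the square lies in
  \<open>Q\<close>, where the extension equals \<open>y\<close>.\<close>

lemma Lebesgue_points_Q:
  fixes y :: "real^2 \<Rightarrow> real"
  assumes "integrable (lebesgue_on Q) y"
  obtains N where "negligible N"
    "\<And>x. x \<in> interior Q \<Longrightarrow> x \<notin> N \<Longrightarrow>
      ((\<lambda>h. integral (rect (x $ 1) (x $ 1 + h) (x $ 2) (x $ 2 + h)) y / h\<^sup>2) \<longlongrightarrow> y x) (at_right 0)"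
proof -
  define f where "f x = (if x \<in> Q then y x else 0)" for x
  have "y integrable_on Q"
    using assms by (intro integrable_on_lebesgue_on) auto
  then have "f integrable_on UNIV"
    unfolding f_def by (simp add: integrable_restrict_UNIV)
  then have "f integrable_on cbox a b" for a b
    by (rule integrable_on_subcbox) simp
  from integrable_ccontinuous_explicit[OF this] obtain N where N: "negligible N" "\<And>x e. x \<notin> N \<Longrightarrow> 0 < e \<Longrightarrow> \<exists>d>0. \<forall>h. 0 < h \<and> h < d \<longrightarrow>
      norm (integral (cbox x (x + h *\<^sub>R One)) f /\<^sub>R h ^ DIM(real^2) - f x) < e"
    by blast
  have One: "(One :: real^2) = (\<chi> k. 1)"
    unfolding vec_eq_iff vec_lambda_beta by (simp add: cart_eq_inner_axis inner_sum_left_Basis)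
  show thesis
  proof (rule that[OF N(1)])
    fix x :: "real^2" assume x: "x \<in> interior Q" "x \<notin> N"
    have box: "cbox x (x + h *\<^sub>R One) = rect (x $ 1) (x $ 1 + h) (x $ 2) (x $ 2 + h)" for h
      unfolding One by (auto simp: rect_def mem_box_cart forall_2)
    have x_bounds: "-1 < x $ 1" "x $ 1 < 1" "-1 < x $ 2" "x $ 2 < 1"
      using x(1) by (simp_all add: interior_Q)
    have lim: "((\<lambda>h. integral (cbox x (x + h *\<^sub>R One)) f /\<^sub>R h ^ DIM(real^2)) \<longlongrightarrow> f x) (at_right 0)"
    proof (rule tendstoI)
      fix e :: real assume "e > 0"
      from N(2)[OF x(2) this] obtain d where "d > 0" "\<forall>h. 0 < h \<and> h < d \<longrightarrow>
        norm (integral (cbox x (x + h *\<^sub>R One)) f /\<^sub>R h ^ DIM(real^2) - f x) < e" by blast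
      then show "\<forall>\<^sub>F h in at_right 0. dist (integral (cbox x (x + h *\<^sub>R One)) f /\<^sub>R h ^ DIM(real^2)) (f x) < e"
        unfolding eventually_at_right_field dist_norm by blast
    qed
    have fx: "f x = y x" using x(1) interior_subset by (auto simp: f_def)
    have ev: "\<forall>\<^sub>F h in at_right 0. integral (cbox x (x + h *\<^sub>R One)) f /\<^sub>R h ^ DIM(real^2)
        = integral (rect (x $ 1) (x $ 1 + h) (x $ 2) (x $ 2 + h)) y / h\<^sup>2"
    proof -
      have "min (1 - x $ 1) (1 - x $ 2) > 0" using x_bounds by simp
      moreover have "integral (cbox x (x + h *\<^sub>R One)) f /\<^sub>R h ^ DIM(real^2)
        = integral (rect (x $ 1) (x $ 1 + h) (x $ 2) (x $ 2 + h)) y / h\<^sup>2"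
        if "h < min (1 - x $ 1) (1 - x $ 2)" for h
      proof -
        have "rect (x $ 1) (x $ 1 + h) (x $ 2) (x $ 2 + h) \<subseteq> Q"
          using that x_bounds by (auto simp: Q_eq_rect rect_def)
        then have "integral (rect (x $ 1) (x $ 1 + h) (x $ 2) (x $ 2 + h)) f
            = integral (rect (x $ 1) (x $ 1 + h) (x $ 2) (x $ 2 + h)) y"
          by (intro integral_cong) (auto simp: f_def)
        then show ?thesis unfolding box by (simp add: divide_inverse mult.commute)
      qed
      ultimately show ?thesis unfolding eventually_at_right_field by blast
    qed
    show "((\<lambda>h. integral (rect (x $ 1) (x $ 1 + h) (x $ 2) (x $ 2 + h)) y / h\<^sup>2) \<longlongrightarrow> y x) (at_right 0)"
      using Lim_transform_eventually[OF lim ev] unfolding fx .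
  qed
qed

section \<open>Oscillation between almost all pairs of points\<close>

lemma common_interval:
  fixes u v l :: real
  assumes "-1 < u" "u < 1" "-1 < v" "v < 1" "\<bar>u - v\<bar> < l" "l \<le> 1"
  obtains p where "-1 \<le> p" "p + l \<le> 1" "p \<le> u" "u < p + l" "p \<le> v" "v < p + l"
  \<comment> \<open>The window starts at the smaller point, unless it would leave [-1,1]; then it is
    pushed against the right end. The strict bounds on the right leave room for small squares with
    lower left corners at the two points.\<close>
  by (rule that[of "min (min u v) (1 - l)"]) (use assms in \<open>auto simp: min_def split: if_splits\<close>)

lemma abs_diff_divide: "k > 0 \<Longrightarrow> \<bar>a - b\<bar> / k = \<bar>a / k - b / k\<bar>" for a b k :: real
  by (simp flip: diff_divide_distrib)

text \<open>With width \<tau> and height \<tau>^3 every error is linear in \<tau>: passing from a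
  small square to the full width costs M \<tau> at either point, and comparing the two strip means
  costs (1 + E)/2 times \<tau>, where E is the squared L^2 norm of \<open>G\<close>. The bound does
  not depend on the side h of the squares, so h may tend to 0.\<close>

lemma weak_partial_Lipschitz_oscillation:
  fixes y G :: "real^2 \<Rightarrow> real"
  assumes wp: "has_weak_partial Q 2 y G"
    and Lip: "\<And>x z. x \<in> Q \<Longrightarrow> z \<in> Q \<Longrightarrow> x $ 2 = z $ 2 \<Longrightarrow> \<bar>y x - y z\<bar> \<le> M * \<bar>x $ 1 - z $ 1\<bar>"
    and M: "M \<ge> 0"
  obtains N C where "negligible N" "C \<ge> 0"
    "\<And>\<tau> x z. x \<in> interior Q - N \<Longrightarrow> z \<in> interior Q - N \<Longrightarrow> 0 < \<tau> \<Longrightarrow> \<tau> \<le> 1 \<Longrightarrow>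
      \<bar>x $ 1 - z $ 1\<bar> < \<tau> \<Longrightarrow> \<bar>x $ 2 - z $ 2\<bar> < \<tau> ^ 3 \<Longrightarrow> \<bar>y x - y z\<bar> \<le> C * \<tau>"
proof -
  have y: "integrable (lebesgue_on Q) y" and G: "G \<in> L2 Q"
    using wp L2_imp_integrable by (auto simp: has_weak_partial_def)
  define E where "E = (\<integral>x. (G x)\<^sup>2 \<partial>lebesgue_on Q)"
  have "E \<ge> 0" unfolding E_def by simp
  define av where "av x h = integral (rect (x $ 1) (x $ 1 + h) (x $ 2) (x $ 2 + h)) y / h\<^sup>2"
    for x :: "real^2" and h
  obtain N where N: "negligible N"
    "\<And>x. x \<in> interior Q \<Longrightarrow> x \<notin> N \<Longrightarrow> (av x \<longlongrightarrow> y x) (at_right 0)"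
    using Lebesgue_points_Q[OF y, folded av_def] by blast
  have "\<bar>y x - y z\<bar> \<le> (2 * M + (1 + E) / 2) * \<tau>"
    if x: "x \<in> interior Q - N" and z: "z \<in> interior Q - N" and \<tau>: "0 < \<tau>" "\<tau> \<le> 1"
      and near: "\<bar>x $ 1 - z $ 1\<bar> < \<tau>" "\<bar>x $ 2 - z $ 2\<bar> < \<tau> ^ 3" for \<tau> x z
  proof -
    have xz: "-1 < x $ 1" "x $ 1 < 1" "-1 < x $ 2" "x $ 2 < 1"
      "-1 < z $ 1" "z $ 1 < 1" "-1 < z $ 2" "z $ 2 < 1"
      using x z by (auto simp: interior_Q)
    obtain p where p: "-1 \<le> p" "p + \<tau> \<le> 1" "p \<le> x $ 1" "x $ 1 < p + \<tau>" "p \<le> z $ 1" "z $ 1 < p + \<tau>"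
      using common_interval[OF xz(1,2,5,6) near(1) \<tau>(2)] by blast
    have "\<tau> ^ 3 \<le> 1" using \<tau> by (simp add: power_le_one)
    from common_interval[OF xz(3,4,7,8) near(2) this] obtain a where a: "-1 \<le> a" "a + \<tau> ^ 3 \<le> 1" "a \<le> x $ 2" "x $ 2 < a + \<tau> ^ 3" "a \<le> z $ 2" "z $ 2 < a + \<tau> ^ 3"
      by blast
    \<comment> \<open>For h < \<open>m\<close> the squares of side h with lower left corners x and z
      stay inside the common window.\<close>
    define m where "m = min (min (p + \<tau> - x $ 1) (p + \<tau> - z $ 1)) (min (a + \<tau> ^ 3 - x $ 2) (a + \<tau> ^ 3 - z $ 2))"
    have "m > 0" using p a by (simp add: m_def)
    have le: "\<bar>av x h - av z h\<bar> \<le> (2 * M + (1 + E) / 2) * \<tau>" if h: "0 < h" "h < m" for h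
    proof -
      \<comment> \<open>\<open>V t\<close> is averaged over the width only; \<open>V t / h\<close>
        is the mean over the full rectangle of width \<tau> and height h.\<close>
      define V where "V t = integral (rect p (p + \<tau>) t (t + h)) y / \<tau>" for t
      have av_V: "\<bar>av w h - V (w $ 2) / h\<bar> \<le> M * \<tau>"
        if w: "p \<le> w $ 1" "w $ 1 + h \<le> p + \<tau>" "a \<le> w $ 2" "w $ 2 + h \<le> a + \<tau> ^ 3" for w
      proof -
        have sub: "rect p (p + \<tau>) (w $ 2) (w $ 2 + h) \<subseteq> Q"
          using p a w by (auto simp: rect_def Q_eq_rect)
        have "\<bar>integral (rect (w $ 1) (w $ 1 + h) (w $ 2) (w $ 2 + h)) y / (w $ 1 + h - w $ 1)
            - integral (rect p (p + \<tau>) (w $ 2) (w $ 2 + h)) y / (p + \<tau> - p)\<bar>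
          \<le> M * (p + \<tau> - p) * (w $ 2 + h - w $ 2)"
          using w h M sub
          by (intro Lipschitz_average_diff integral_rect_restrict(3)[OF y sub] Lip) auto
        then have "\<bar>integral (rect (w $ 1) (w $ 1 + h) (w $ 2) (w $ 2 + h)) y / h - V (w $ 2)\<bar> / h
            \<le> M * \<tau> * h / h"
          using h by (intro divide_right_mono) (auto simp: V_def)
        moreover have "\<bar>integral (rect (w $ 1) (w $ 1 + h) (w $ 2) (w $ 2 + h)) y / h - V (w $ 2)\<bar> / h
            = \<bar>av w h - V (w $ 2) / h\<bar>"
          using h by (simp add: av_def power2_eq_square abs_diff_divide)
        ultimately show ?thesis using h by simp
      qed
      have "\<bar>integral (rect p (p + \<tau>) (x $ 2) (x $ 2 + h)) y / (x $ 2 + h - x $ 2)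
          - integral (rect p (p + \<tau>) (z $ 2) (z $ 2 + h)) y / (z $ 2 + h - z $ 2)\<bar>
        \<le> integral (rect p (p + \<tau>) a (a + \<tau> ^ 3)) (\<lambda>x. \<bar>G x\<bar>)"
        using p a h \<tau> by (intro weak_partial_average_diff[OF wp]) (auto simp: m_def)
      \<comment> \<open>The window has area \<tau>^4, so the weight s = 1/\<tau>^2 balances Young's
        inequality: both terms become multiples of \<tau>^2, and dividing by the width \<tau> leaves
        order \<tau>.\<close>
      also have "\<dots> \<le> (1 / \<tau>\<^sup>2 * ((p + \<tau> - p) * (a + \<tau> ^ 3 - a)) + E / (1 / \<tau>\<^sup>2)) / 2"
        unfolding E_def using p a \<tau> by (intro integral_abs_rect_le[OF G]) auto
      also have "\<dots> = (1 + E) / 2 * \<tau>\<^sup>2"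
        using \<tau> by (simp add: power2_eq_square power3_eq_cube field_simps)
      finally have "\<bar>integral (rect p (p + \<tau>) (x $ 2) (x $ 2 + h)) y / h
          - integral (rect p (p + \<tau>) (z $ 2) (z $ 2 + h)) y / h\<bar> / \<tau> \<le> (1 + E) / 2 * \<tau>\<^sup>2 / \<tau>"
        using \<tau> by (intro divide_right_mono) auto
      moreover have "\<bar>integral (rect p (p + \<tau>) (x $ 2) (x $ 2 + h)) y / h
          - integral (rect p (p + \<tau>) (z $ 2) (z $ 2 + h)) y / h\<bar> / \<tau> = \<bar>V (x $ 2) / h - V (z $ 2) / h\<bar>"
        using \<tau> by (simp add: V_def abs_diff_divide mult.commute)
      ultimately have "\<bar>V (x $ 2) / h - V (z $ 2) / h\<bar> \<le> (1 + E) / 2 * \<tau>"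
        using \<tau> by (simp add: power2_eq_square)
      moreover have "\<bar>av x h - V (x $ 2) / h\<bar> \<le> M * \<tau>" "\<bar>av z h - V (z $ 2) / h\<bar> \<le> M * \<tau>"
        using p a h by (auto intro!: av_V simp: m_def)
      ultimately show ?thesis unfolding distrib_right by linarith
    qed
    have "((\<lambda>h. \<bar>av x h - av z h\<bar>) \<longlongrightarrow> \<bar>y x - y z\<bar>) (at_right 0)"
      using x z by (intro tendsto_intros N(2)) auto
    moreover have "\<forall>\<^sub>F h in at_right 0. \<bar>av x h - av z h\<bar> \<le> (2 * M + (1 + E) / 2) * \<tau>"
      unfolding eventually_at_right_field using \<open>m > 0\<close> le by blast
    ultimately show ?thesis
      by (rule tendsto_upperbound) simp
  qed
  moreover have "2 * M + (1 + E) / 2 \<ge> 0" using M \<open>E \<ge> 0\<close> by simp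
  ultimately show thesis using that N(1) by blast
qed

section \<open>Hoelder continuous representatives\<close>

text \<open>A Hoelder bound at small distances implies uniform continuity, which yields a continuous
  extension to the closure; the bound itself survives by approximating both points by sequences in
  \<open>X\<close>.\<close>

lemma Hoelder_extension_closure:
  fixes f :: "'a::metric_space \<Rightarrow> 'b::complete_space"
  assumes H: "\<And>x z. x \<in> X \<Longrightarrow> z \<in> X \<Longrightarrow> dist x z < \<delta> \<Longrightarrow> dist (f x) (f z) \<le> C * dist x z powr \<alpha>"
    and pos: "\<delta> > 0" "\<alpha> > 0"
  obtains g where "continuous_on (closure X) g" "\<And>x. x \<in> X \<Longrightarrow> g x = f x"
    "\<And>x z. x \<in> closure X \<Longrightarrow> z \<in> closure X \<Longrightarrow> dist x z < \<delta> \<Longrightarrow> dist (g x) (g z) \<le> C * dist x z powr \<alpha>"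
proof -
  have "uniformly_continuous_on X f"
    unfolding uniformly_continuous_on_def
  proof (intro allI impI)
    fix e :: real assume "e > 0"
    \<comment> \<open>\<open>C\<close> may be zero or negative, so the radius is computed with a
      constant that is at least 1.\<close>
    define D where "D = max C 1"
    have "D \<ge> 1" "C \<le> D" by (auto simp: D_def)
    have "dist (f z) (f x) < e"
      if "x \<in> X" "z \<in> X" "dist z x < min \<delta> ((e / D) powr (1 / \<alpha>))" for x z
    proof -
      have "dist z x powr \<alpha> < ((e / D) powr (1 / \<alpha>)) powr \<alpha>"
        using that pos by (intro powr_less_mono2) auto
      also have "\<dots> = e / D" using pos \<open>e > 0\<close> \<open>D \<ge> 1\<close> by (simp add: powr_powr)
      finally have "D * dist z x powr \<alpha> < e" using \<open>D \<ge> 1\<close> by (simp add: field_simps)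
      moreover have "dist (f z) (f x) \<le> C * dist z x powr \<alpha>" using that by (intro H) auto
      moreover have "C * dist z x powr \<alpha> \<le> D * dist z x powr \<alpha>" using \<open>C \<le> D\<close> by (intro mult_right_mono) auto
      ultimately show ?thesis by linarith
    qed
    moreover have "min \<delta> ((e / D) powr (1 / \<alpha>)) > 0" using pos \<open>e > 0\<close> \<open>D \<ge> 1\<close> by simp
    ultimately show "\<exists>d>0. \<forall>x\<in>X. \<forall>z\<in>X. dist z x < d \<longrightarrow> dist (f z) (f x) < e" by blast
  qed
  then obtain g where g: "uniformly_continuous_on (closure X) g" "\<And>x. x \<in> X \<Longrightarrow> f x = g x"
    using uniformly_continuous_on_extension_on_closure by metis
  have cont: "continuous_on (closure X) g"
    by (rule uniformly_continuous_imp_continuous[OF g(1)])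
  show thesis
  proof (rule that[OF cont])
    fix x z assume xz: "x \<in> closure X" "z \<in> closure X" "dist x z < \<delta>"
    show "dist (g x) (g z) \<le> C * dist x z powr \<alpha>"
    \<comment> \<open>The limit of \<open>powr\<close> is taken at a nonzero base; for x = z both
      sides are 0.\<close>
    proof (cases "x = z")
      case False
      obtain u v where u: "\<And>n. u n \<in> X" "u \<longlonglongrightarrow> x" and v: "\<And>n. v n \<in> X" "v \<longlonglongrightarrow> z"
        using xz(1,2) unfolding closure_sequential by metis
      have d: "(\<lambda>n. dist (u n) (v n)) \<longlonglongrightarrow> dist x z"
        by (intro tendsto_dist u v)
      have "\<forall>\<^sub>F n in sequentially. u n \<in> closure X" "\<forall>\<^sub>F n in sequentially. v n \<in> closure X"
        using u(1) v(1) closure_subset by (auto intro!: always_eventually)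
      then have "(\<lambda>n. g (u n)) \<longlonglongrightarrow> g x" "(\<lambda>n. g (v n)) \<longlonglongrightarrow> g z"
        by (auto intro: continuous_on_tendsto_compose[OF cont u(2) xz(1)]
            continuous_on_tendsto_compose[OF cont v(2) xz(2)])
      then have "(\<lambda>n. dist (g (u n)) (g (v n))) \<longlonglongrightarrow> dist (g x) (g z)" by (rule tendsto_dist)
      moreover have "(\<lambda>n. C * dist (u n) (v n) powr \<alpha>) \<longlonglongrightarrow> C * dist x z powr \<alpha>"
        using False by (intro tendsto_intros d) auto
      moreover have "\<forall>\<^sub>F n in sequentially. dist (g (u n)) (g (v n)) \<le> C * dist (u n) (v n) powr \<alpha>"
        using order_tendstoD(2)[OF d xz(3)] by eventually_elim (use H u v g(2) in metis)
      ultimately show ?thesis by (intro tendsto_le[OF sequentially_bot]) auto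
    qed simp
  qed (simp add: g(2))
qed

text \<open>Pairs at distance at least \<delta> are handled by compactness: g varies by at most some
  B on K, and B / \<delta>^\<alpha> is absorbed into the constant, which therefore depends on K
  while the exponent does not.\<close>

lemma locally_Hoelder_onI:
  assumes cont: "continuous_on S g" and \<alpha>: "0 < \<alpha>" "\<alpha> \<le> 1" and \<delta>: "\<delta> > 0"
    and H: "\<And>x z. x \<in> S \<Longrightarrow> z \<in> S \<Longrightarrow> dist x z < \<delta> \<Longrightarrow> dist (g x) (g z) \<le> C * dist x z powr \<alpha>"
  shows "locally_Hoelder_on S g"
  unfolding locally_Hoelder_on_def
proof (rule exI[of _ \<alpha>], intro conjI allI impI \<alpha>)
  fix K assume K: "compact K \<and> K \<subseteq> S"
  then have "bounded (g ` K)"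
    using cont by (intro compact_imp_bounded compact_continuous_image) (auto intro: continuous_on_subset)
  then obtain B where B: "\<And>u v. u \<in> K \<Longrightarrow> v \<in> K \<Longrightarrow> dist (g u) (g v) \<le> B"
    by (metis bounded_two_points image_eqI)
  show "\<exists>C. \<forall>x\<in>K. \<forall>z\<in>K. dist (g x) (g z) \<le> C * dist x z powr \<alpha>"
  proof (intro exI[of _ "max C (B / \<delta> powr \<alpha>)"] ballI)
    fix x z assume xz: "x \<in> K" "z \<in> K"
    show "dist (g x) (g z) \<le> max C (B / \<delta> powr \<alpha>) * dist x z powr \<alpha>"
    proof (cases "dist x z < \<delta>")
      case True
      have "dist (g x) (g z) \<le> C * dist x z powr \<alpha>" using H True xz K by blast
      also have "\<dots> \<le> max C (B / \<delta> powr \<alpha>) * dist x z powr \<alpha>" by (intro mult_right_mono) auto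
      finally show ?thesis .
    next
      case False
      have "0 \<le> B" using B[OF xz] zero_le_dist order_trans by blast
      have "dist (g x) (g z) \<le> B" using B xz by blast
      also have "\<dots> = B / \<delta> powr \<alpha> * \<delta> powr \<alpha>" using \<delta> by simp
      also have "\<dots> \<le> max C (B / \<delta> powr \<alpha>) * dist x z powr \<alpha>"
        using False \<alpha> \<delta> \<open>0 \<le> B\<close> by (intro mult_mono powr_mono2) (auto simp: max_def intro: order_trans[of 0 "B / \<delta> powr \<alpha>"])
      finally show ?thesis .
    qed
  qed
qed

section \<open>From the shear map to its second component and back\<close>

lemma Ck_continuous: "Ck k f \<Longrightarrow> continuous_on UNIV f"
  by (cases k) (auto intro: differentiable_imp_continuous_on)

lemma integrable_scaleR_continuous:
  fixes f :: "real^2 \<Rightarrow> 'b::euclidean_space"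
  assumes c: "continuous_on UNIV c" and f: "integrable (lebesgue_on Q) f"
  shows "integrable (lebesgue_on Q) (\<lambda>x. (c x :: real) *\<^sub>R f x)"
proof -
  have "bounded (c ` Q)"
    using c by (intro compact_imp_bounded compact_continuous_image) (auto simp: Q_def intro: continuous_on_subset)
  then obtain B where B: "\<And>x. x \<in> Q \<Longrightarrow> \<bar>c x\<bar> \<le> B" by (auto simp: bounded_iff)
  show ?thesis
  proof (rule Bochner_Integration.integrable_bound)
    show "integrable (lebesgue_on Q) (\<lambda>x. B *\<^sub>R norm (f x))" using f by simp
    have "c \<in> borel_measurable (lebesgue_on Q)"
      by (rule continuous_imp_measurable_on_sets_lebesgue[OF continuous_on_subset[OF c]]) auto
    then show "(\<lambda>x. c x *\<^sub>R f x) \<in> borel_measurable (lebesgue_on Q)"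
      by (rule borel_measurable_scaleR[OF _ borel_measurable_integrable[OF f]])
    show "AE x in lebesgue_on Q. norm (c x *\<^sub>R f x) \<le> norm (B *\<^sub>R norm (f x))"
    proof (rule AE_I2)
      fix x assume "x \<in> space (lebesgue_on Q)"
      then have "\<bar>c x\<bar> \<le> \<bar>B\<bar>" using B[of x] by simp
      then have "\<bar>c x\<bar> * norm (f x) \<le> \<bar>B\<bar> * norm (f x)"
        by (intro mult_right_mono) auto
      then show "norm (c x *\<^sub>R f x) \<le> norm (B *\<^sub>R norm (f x))" by (simp add: abs_mult)
    qed
  qed
qed

text \<open>Taking a component is bounded linear and so commutes with the integral of an integrable
  function. Integrability holds because a test function and its partial derivatives are continuous,
  hence bounded on the compact square.\<close>

lemma has_weak_partial_component:
  fixes u g :: "real^2 \<Rightarrow> real^'m"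
  assumes wp: "has_weak_partial Q i u g"
  shows "has_weak_partial Q i (\<lambda>x. u x $ j) (\<lambda>x. g x $ j)"
proof -
  have L2: "(\<lambda>x. f x $ j) \<in> L2 Q" if "f \<in> L2 Q" for f :: "real^2 \<Rightarrow> real^'m"
  proof -
    have meas: "(\<lambda>x. f x $ j) \<in> borel_measurable (lebesgue_on Q)"
      using that unfolding cart_eq_inner_axis[of "f _" j] by (auto simp: L2_def)
    moreover have "integrable (lebesgue_on Q) (\<lambda>x. (norm (f x $ j))\<^sup>2)"
    proof (rule Bochner_Integration.integrable_bound)
      show "integrable (lebesgue_on Q) (\<lambda>x. (norm (f x))\<^sup>2)" using that by (simp add: L2_def)
      show "(\<lambda>x. (norm (f x $ j))\<^sup>2) \<in> borel_measurable (lebesgue_on Q)" using meas by measurable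
      show "AE x in lebesgue_on Q. norm ((norm (f x $ j))\<^sup>2) \<le> norm ((norm (f x))\<^sup>2)"
        using power_mono[OF component_le_norm_cart abs_ge_zero, of "f _" j 2] by (intro AE_I2) simp
    qed
    ultimately show ?thesis by (simp add: L2_def)
  qed
  have comp: "(\<integral>x. c x *\<^sub>R f x $ j \<partial>lebesgue_on Q) = (\<integral>x. c x *\<^sub>R f x \<partial>lebesgue_on Q) $ j"
    if "continuous_on UNIV c" "f \<in> L2 Q" for c and f :: "real^2 \<Rightarrow> real^'m"
    using integral_bounded_linear[OF bounded_linear_vec_nth[of j]
        integrable_scaleR_continuous[OF that(1) L2_imp_integrable[OF that(2)]]] by simp
  have cont: "continuous_on UNIV \<phi>" "continuous_on UNIV (partial i \<phi>)" if "\<phi> \<in> test_functions Q" for \<phi>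
  proof -
    have "Ck (Suc 0) \<phi>" using that by (auto simp: test_functions_def)
    then show "continuous_on UNIV \<phi>" "continuous_on UNIV (partial i \<phi>)"
      by (auto intro: Ck_continuous[of "Suc 0"])
  qed
  have u: "u \<in> L2 Q" and g: "g \<in> L2 Q" using wp by (auto simp: has_weak_partial_def)
  show ?thesis
    unfolding has_weak_partial_def
  proof (intro conjI ballI L2 u g)
    fix \<phi> :: "real^2 \<Rightarrow> real" assume \<phi>: "\<phi> \<in> test_functions Q"
    have "(\<integral>x. partial i \<phi> x *\<^sub>R u x \<partial>lebesgue_on Q) = - (\<integral>x. \<phi> x *\<^sub>R g x \<partial>lebesgue_on Q)"
      using wp \<phi> by (simp add: has_weak_partial_def)
    then show "(\<integral>x. partial i \<phi> x *\<^sub>R u x $ j \<partial>lebesgue_on Q) = - (\<integral>x. \<phi> x *\<^sub>R g x $ j \<partial>lebesgue_on Q)"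
      using comp[OF cont(2)[OF \<phi>] u] comp[OF cont(1)[OF \<phi>] g] by simp
  qed
qed

lemma shear_Hoelder_representative:
  assumes W: "shear \<sigma> \<in> W12 Q"
    and Lip: "\<And>x1 x1' x2. vector [x1, x2] \<in> Q \<Longrightarrow> vector [x1', x2] \<in> Q \<Longrightarrow>
      \<bar>\<sigma> (vector [x1, x2]) - \<sigma> (vector [x1', x2])\<bar> \<le> M * \<bar>x1 - x1'\<bar>"
  shows "\<exists>w. (AE x in lebesgue_on Q. w x = shear \<sigma> x) \<and> locally_Hoelder_on (interior Q) w"
proof -
  have comp: "shear \<sigma> x $ 1 = x $ 1" "shear \<sigma> x $ 2 = x $ 2 + \<sigma> x" for x
    by (simp_all add: shear_def axis_def)
  obtain g where "has_weak_partial Q 2 (shear \<sigma>) g"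
    using W by (auto simp: W12_def)
  then have wp: "has_weak_partial Q 2 (\<lambda>x. shear \<sigma> x $ 2) (\<lambda>x. g x $ 2)"
    by (rule has_weak_partial_component)
  \<comment> \<open>The oscillation bound asks for a nonnegative constant, and the sign of
    \<open>M\<close> is not prescribed.\<close>
  have Lip2: "\<bar>shear \<sigma> x $ 2 - shear \<sigma> z $ 2\<bar> \<le> \<bar>M\<bar> * \<bar>x $ 1 - z $ 1\<bar>"
    if "x \<in> Q" "z \<in> Q" "x $ 2 = z $ 2" for x z
  proof -
    have eq: "vector [x $ 1, x $ 2] = x" "vector [z $ 1, x $ 2] = z"
      using that by (auto simp: vec_eq_iff forall_2)
    have "\<bar>\<sigma> x - \<sigma> z\<bar> \<le> M * \<bar>x $ 1 - z $ 1\<bar>"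
      using Lip[of "x $ 1" "x $ 2" "z $ 1"] that unfolding eq by simp
    also have "\<dots> \<le> \<bar>M\<bar> * \<bar>x $ 1 - z $ 1\<bar>" by (intro mult_right_mono) auto
    finally show ?thesis using that by (simp add: comp)
  qed
  obtain N C where N: "negligible N" "C \<ge> 0" and osc:
    "\<And>\<tau> x z. x \<in> interior Q - N \<Longrightarrow> z \<in> interior Q - N \<Longrightarrow> 0 < \<tau> \<Longrightarrow> \<tau> \<le> 1 \<Longrightarrow>
      \<bar>x $ 1 - z $ 1\<bar> < \<tau> \<Longrightarrow> \<bar>x $ 2 - z $ 2\<bar> < \<tau> ^ 3 \<Longrightarrow> \<bar>shear \<sigma> x $ 2 - shear \<sigma> z $ 2\<bar> \<le> C * \<tau>"
    using weak_partial_Lipschitz_oscillation[OF wp Lip2 abs_ge_zero] by blast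
  have H: "dist (shear \<sigma> x) (shear \<sigma> z) \<le> (2 + 2 * C) * dist x z powr (1/3)"
    if xz: "x \<in> interior Q - N" "z \<in> interior Q - N" and r: "dist x z < 1/8" for x z
  proof (cases "x = z")
    case False
    \<comment> \<open>The factor 2 gives \<tau>^3 = 8 \<open>dist x z\<close>, which strictly
      exceeds both coordinate differences, and distance below 1/8 gives \<tau> \<le> 1. Then
      \<tau>^3 \<le> \<tau> covers the weaker condition on the first coordinate and bounds the first
      component of the shear map by \<tau>.\<close>
    define \<tau> where "\<tau> = 2 * dist x z powr (1/3)"
    have pos: "dist x z > 0" using False by simp
    then have "\<tau> > 0" by (simp add: \<tau>_def)
    have cube: "\<tau> ^ 3 = 8 * dist x z"
      using pos by (simp add: \<tau>_def power_mult_distrib powr_power)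
    have "\<tau> \<le> 1"
    proof (rule ccontr)
      assume "\<not> \<tau> \<le> 1"
      then have "1 < \<tau> ^ 3" by (simp add: one_less_power)
      with cube r show False by simp
    qed
    have "\<tau> ^ 3 \<le> \<tau>"
      using power_decreasing[of 1 3 \<tau>] \<open>\<tau> > 0\<close> \<open>\<tau> \<le> 1\<close> by simp
    have c: "\<bar>x $ k - z $ k\<bar> \<le> dist x z" for k
      using component_le_norm_cart[of "x - z" k] by (simp add: dist_norm)
    have "\<bar>x $ k - z $ k\<bar> < \<tau> ^ 3" for k using c[of k] pos cube by linarith
    then have o: "\<bar>shear \<sigma> x $ 2 - shear \<sigma> z $ 2\<bar> \<le> C * \<tau>"
      using \<open>\<tau> ^ 3 \<le> \<tau>\<close> \<open>\<tau> > 0\<close> \<open>\<tau> \<le> 1\<close> by (intro osc xz) (auto intro: less_le_trans)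
    have "dist (shear \<sigma> x) (shear \<sigma> z) \<le> \<bar>shear \<sigma> x $ 1 - shear \<sigma> z $ 1\<bar> + \<bar>shear \<sigma> x $ 2 - shear \<sigma> z $ 2\<bar>"
      using norm_le_l1_cart[of "shear \<sigma> x - shear \<sigma> z"] by (simp add: dist_norm UNIV_2)
    also have "\<dots> \<le> \<tau> + C * \<tau>"
      using o c[of 1] cube pos \<open>\<tau> ^ 3 \<le> \<tau>\<close> by (simp add: comp(1))
    also have "\<dots> = (2 + 2 * C) * dist x z powr (1/3)" by (simp add: \<tau>_def algebra_simps)
    finally show ?thesis .
  qed simp
  obtain w where w: "continuous_on (closure (interior Q - N)) w"
    "\<And>x. x \<in> interior Q - N \<Longrightarrow> w x = shear \<sigma> x"
    "\<And>x z. x \<in> closure (interior Q - N) \<Longrightarrow> z \<in> closure (interior Q - N) \<Longrightarrow> dist x z < 1/8 \<Longrightarrow>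
      dist (w x) (w z) \<le> (2 + 2 * C) * dist x z powr (1/3)"
    by (rule Hoelder_extension_closure[of "interior Q - N" "1/8" "shear \<sigma>" "2 + 2 * C" "1/3"]) (use H in auto)
  \<comment> \<open>A nonempty open set is not negligible, so every interior point is a limit of
    points outside \<open>N\<close>, and the extension \<open>w\<close> is defined and Hoelder on
    the whole interior.\<close>
  have dense: "interior Q \<subseteq> closure (interior Q - N)"
  proof
    fix x assume x: "x \<in> interior Q"
    show "x \<in> closure (interior Q - N)"
      unfolding closure_iff_nhds_not_empty
    proof (intro allI impI notI)
      fix A U assume U: "U \<subseteq> A" "open U" "x \<in> U" and e: "(interior Q - N) \<inter> A = {}"
      then have "U \<inter> interior Q \<subseteq> N" by blast
      then have "negligible (U \<inter> interior Q)" using N(1) negligible_subset by blast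
      moreover have "open (U \<inter> interior Q)" "U \<inter> interior Q \<noteq> {}" using U x by auto
      ultimately show False using open_not_negligible by blast
    qed
  qed
  have "locally_Hoelder_on (interior Q) w"
    by (rule locally_Hoelder_onI[of _ _ "1/3" "1/8" "2 + 2 * C"])
      (use w dense in \<open>auto intro: continuous_on_subset\<close>)
  moreover have "AE x in lebesgue_on Q. w x = shear \<sigma> x"
  proof -
    have "negligible (Q - interior Q)"
      unfolding Q_def interior_cbox by (rule negligible_frontier_interval)
    then have "AE x in lebesgue_on Q. x \<notin> Q - interior Q"
      by (rule AE_lebesgue_on_negligible)
    moreover have "AE x in lebesgue_on Q. x \<notin> N"
      by (rule AE_lebesgue_on_negligible[OF N(1)])
    moreover have "AE x in lebesgue_on Q. x \<in> Q" by (rule AE_I2) simp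
    ultimately show ?thesis by eventually_elim (use w(2) in auto)
  qed
  ultimately show ?thesis by blast
qed

theorem theorem4p7:
  fixes lam :: real and h :: "real \<Rightarrow> ennreal" and h' :: "real \<Rightarrow> real"
    and \<Gamma> :: "(real^2) set" and \<sigma>0 \<sigma> :: "real^2 \<Rightarrow> real" and M :: real
  assumes lam_pos: "lam > 0"
    and H0_finite: "\<And>s. s > 0 \<Longrightarrow> h s < \<infinity>"
    and H0_deriv: "\<And>s. s > 0 \<Longrightarrow> ((\<lambda>r. enn2real (h r)) has_real_derivative h' s) (at s)"
    and H0_C1: "continuous_on {0<..} h'"
    and H0_convex: "strictly_convex_on {0<..} (\<lambda>r. enn2real (h r))"
    and H1: "(h \<longlongrightarrow> \<infinity>) (at_right 0)"
    and H2_deriv: "h' 1 = 0"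
    and H2_infinite: "\<And>s. s \<le> 0 \<Longrightarrow> h s = \<infinity>"
    and H3: "\<exists>q1 q2. q1 > 0 \<and> (\<forall>s>1. h' s \<le> 2 * q1 * s + q2)"
    and H4: "\<exists>K s0. K > 0 \<and> s0 > 0 \<and> (\<forall>s. 0 < s \<and> s < s0 \<longrightarrow> h (s / 2) \<le> ennreal K * h s)"
    and Gamma: "\<Gamma> \<subseteq> frontier Q"
    and sigma0: "\<sigma>0 \<in> W12 Q" "energy lam h (shear \<sigma>0) < \<infinity>"
    and minimizer:
      "strong_local_minimizer (energy lam h) (admissible_shears lam h \<Gamma> \<sigma>0) (shear \<sigma>)"
    and lipschitz: "\<And>x1 x1' x2. vector [x1, x2] \<in> Q \<Longrightarrow> vector [x1', x2] \<in> Q \<Longrightarrow>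
      \<bar>\<sigma> (vector [x1, x2]) - \<sigma> (vector [x1', x2])\<bar> \<le> M * \<bar>x1 - x1'\<bar>"
  shows "\<exists>w. (AE x in lebesgue_on Q. w x = shear \<sigma> x) \<and> locally_Hoelder_on (interior Q) w"
proof (rule shear_Hoelder_representative[OF _ lipschitz])
  show "shear \<sigma> \<in> W12 Q"
    using minimizer by (auto simp: strong_local_minimizer_def admissible_shears_def)
qed

end
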